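(* Let $z:\mathbb Z^2\to\hat{\mathbb C}$ be a discrete holomorphic function, and consider the square lattice with face weights $(a_{i,j})_{(i,j)\in\mathbb Z^2}$ given by $$a_{i,j}=\begin{cases} z_{\frac{i+j+[i+j]_2}{2},\frac{-(i+j)+[i+j]_2}{2}} & \text{if }[i-j]_4\in\{0,3\},\\ z_{\frac{i+j+[i+j]_2}{2},\frac{-(i+j)+[i+j]_2}{2}+1} & \text{if }[i-j]_4\in\{1,2\}.\end{cases}$$ For $(i,j)\in\mathbb Z^2$ with $i+j\ge2$, put $d=i-j+1$ and $(i',(j-1)')=\bigl(\frac{d+[d]_2}{2},\frac{-d+[d]_2}{2}\bigr)$. Then $$z_{i,j}=\begin{cases}Y(A_{i+j-2}[z_{i',(j-1)'}],a)&\text{if }[i+j]_4\in\{0,3\},\\ Y(A_{i+j-2}[z_{i',(j-1)'+1}],a)&\text{if }[i+j]_4\in\{1,2\}.\end{cases}$$ Here $A_k[z_{i',(j-1)'}]$ (resp. $A_k[z_{i',(j-1)'+1}]$) denotes the Aztec diamond $A_k(u,v)$ centered at any face $(u,v)$ with $u+v=d$ and $[u-v]_4\in\{0,3\}$ (resp. $[u-v]_4\in\{1,2\}$), i.e. a face given this label by the first (resp. second) line of the definition of $a$; since $a$ is invariant under translation by $(2,-2)$, the choice does not matter.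
   Context: $\hat{\mathbb C}=\mathbb C\cup\{\infty\}$ is identified with $\mathbb{CP}^1$, with the usual arithmetic; $[n]_q\in\{0,\dots,q-1\}$ is the residue of $n$ modulo $q$. A discrete holomorphic function is a map $z:\mathbb Z^2\to\hat{\mathbb C}$ such that for all $(i,j)$, $\frac{(z_{i,j}-z_{i+1,j})(z_{i+1,j+1}-z_{i,j+1})}{(z_{i+1,j}-z_{i+1,j+1})(z_{i,j+1}-z_{i,j})}=-1$. Ratio function of oriented dimers. Consider the square lattice whose faces are the unit squares centered at the points of $\mathbb Z^2$, face $(i,j)$ carrying the weight $a_{i,j}$. For $k\ge1$, the Aztec diamond $A_k(i,j)$ is the subgraph formed by the vertices and edges of its internal faces, which are the faces $(i',j')$ with $|i'-i|+|j'-j|<k$; its open faces are the $(i',j')$ with $|i'-i|+|j'-j|=k$; $F$ is the set of all internal and open faces. The graph is bipartite. A Kasteleyn orientation is a skew-symmetric function $\varphi$ from directed edges to $\{-1,1\}$ such that for every internal face $f$, $\prod_{wb\in\partial f}\varphi_{(w,b)}=-1$ (product over the four boundary edges, each directed from white to black). An oriented dimer configuration $\vec{M}$ is a set of directed edges whose undirected version is a perfect matching (each matched edge carrying exactly one direction). Its weight is $\prod_{\vec e\in\vec M}\varphi_{\vec e}\,a_{f(\vec e)}$, where $f(\vec e)\in F$ is the face to the right of $\vec e$. $Z(A,a,\varphi)$ is the sum of the weights of all oriented dimer configurations of $A$, and $Y(A,a)=\bigl(\prod_{f\in F}a_f\bigr)\frac{Z(A,a^{-1},\varphi)}{Z(A,a,\varphi)}$,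 where $a^{-1}$ denotes the inverse face weights; this does not depend on $\varphi$. For size $0$, $Y(A_0(i,j),a)=a_{i,j}$. $Y$ is regarded as a rational function of the face weights. Standing assumption: the data are generic, so that all expressions are well defined. *)

theory Defs
  imports "HOL-Analysis.Analysis"
begin

section \<open>The Riemann sphere and discrete holomorphic functions\<close>

datatype riemann_sphere = Finite complex | Infty

text \<open>Homogeneous coordinates, identifying the sphere with the complex projective line.\<close>

primrec hnum :: "riemann_sphere \<Rightarrow> complex" where
  "hnum (Finite w) = w"
| "hnum Infty = 1"

primrec hden :: "riemann_sphere \<Rightarrow> complex" where
  "hden (Finite w) = 1"
| "hden Infty = 0"

text \<open>The point with homogeneous coordinates \<open>[p : q]\<close>; meaningful for \<open>(p, q) \<noteq> (0, 0)\<close>.\<close>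

definition proj_point :: "complex \<Rightarrow> complex \<Rightarrow> riemann_sphere" where
  "proj_point p q = (if q = 0 then Infty else Finite (p / q))"

text \<open>\<open>hdiff a b\<close> is \<open>a - b\<close> for finite points. Every point occurs once in the numerator and once in
  the denominator of the cross-ratio, so replacing differences by \<open>hdiff\<close> extends the cross-ratio
  continuously to infinity. If the denominator vanishes, the quotient below is \<open>0\<close> by convention,
  hence is not \<open>-1\<close>.\<close>

definition hdiff :: "riemann_sphere \<Rightarrow> riemann_sphere \<Rightarrow> complex" where
  "hdiff a b = hnum a * hden b - hnum b * hden a"

definition cross_ratio ::
    "riemann_sphere \<Rightarrow> riemann_sphere \<Rightarrow> riemann_sphere \<Rightarrow> riemann_sphere \<Rightarrow> complex" where
  "cross_ratio a b c d = (hdiff a b * hdiff c d) / (hdiff b c * hdiff d a)"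

definition discrete_holomorphic :: "(int \<Rightarrow> int \<Rightarrow> riemann_sphere) \<Rightarrow> bool" where
  "discrete_holomorphic z \<longleftrightarrow>
     (\<forall>i j. cross_ratio (z i j) (z (i + 1) j) (z (i + 1) (j + 1)) (z i (j + 1)) = -1)"

section \<open>Aztec diamonds and oriented dimers\<close>

type_synonym face = "int \<times> int"

text \<open>Face \<open>(i, j)\<close> is the unit square centred at \<open>(i, j)\<close>; vertex \<open>(p, q)\<close> stands for the point
  \<open>(p + 1/2, q + 1/2)\<close>.\<close>

type_synonym vertex = "int \<times> int"
type_synonym dart = "vertex \<times> vertex"

definition face_corners :: "face \<Rightarrow> vertex set" where
  "face_corners f = {fst f - 1, fst f} \<times> {snd f - 1, snd f}"

definition adjacent :: "vertex \<Rightarrow> vertex \<Rightarrow> bool" where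
  "adjacent v w \<longleftrightarrow> \<bar>fst v - fst w\<bar> + \<bar>snd v - snd w\<bar> = 1"

definition face_darts :: "face \<Rightarrow> dart set" where
  "face_darts f = {(v, w). v \<in> face_corners f \<and> w \<in> face_corners f \<and> adjacent v w}"

definition white :: "vertex \<Rightarrow> bool" where
  "white v \<longleftrightarrow> even (fst v + snd v)"

text \<open>For a dart with direction \<open>(dx, dy)\<close>, the centre of the face to its right is the midpoint of
  the dart plus \<open>(dy, -dx) / 2\<close>.\<close>

definition right_face :: "dart \<Rightarrow> face" where
  "right_face e = (let p = fst (fst e); q = snd (fst e);
                       dx = fst (snd e) - p; dy = snd (snd e) - q
                   in (p + (1 + dx + dy) div 2, q + (1 + dy - dx) div 2))"

definition internal_faces :: "nat \<Rightarrow> face \<Rightarrow> face set" where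
  "internal_faces k c = {f. \<bar>fst f - fst c\<bar> + \<bar>snd f - snd c\<bar> < int k}"

definition open_faces :: "nat \<Rightarrow> face \<Rightarrow> face set" where
  "open_faces k c = {f. \<bar>fst f - fst c\<bar> + \<bar>snd f - snd c\<bar> = int k}"

definition aztec_faces :: "nat \<Rightarrow> face \<Rightarrow> face set" where
  "aztec_faces k c = internal_faces k c \<union> open_faces k c"

definition aztec_vertices :: "nat \<Rightarrow> face \<Rightarrow> vertex set" where
  "aztec_vertices k c = (\<Union>f\<in>internal_faces k c. face_corners f)"

definition aztec_darts :: "nat \<Rightarrow> face \<Rightarrow> dart set" where
  "aztec_darts k c = (\<Union>f\<in>internal_faces k c. face_darts f)"

definition kasteleyn :: "nat \<Rightarrow> face \<Rightarrow> (dart \<Rightarrow> complex) \<Rightarrow> bool" where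
  "kasteleyn k c \<phi> \<longleftrightarrow>
     (\<forall>(v, w)\<in>aztec_darts k c. \<phi> (v, w) \<in> {-1, 1} \<and> \<phi> (w, v) = - \<phi> (v, w)) \<and>
     (\<forall>f\<in>internal_faces k c. (\<Prod>e\<in>{e \<in> face_darts f. white (fst e)}. \<phi> e) = -1)"

text \<open>A set of darts such that every vertex is an endpoint of exactly one of them; in particular
  no edge is taken in both directions.\<close>

definition oriented_dimers :: "nat \<Rightarrow> face \<Rightarrow> dart set set" where
  "oriented_dimers k c =
     {M. M \<subseteq> aztec_darts k c \<and> (\<forall>v\<in>aztec_vertices k c. \<exists>!e. e \<in> M \<and> (v = fst e \<or> v = snd e))}"

definition aztec_Z :: "nat \<Rightarrow> face \<Rightarrow> (dart \<Rightarrow> complex) \<Rightarrow> (face \<Rightarrow> complex) \<Rightarrow> complex" where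
  "aztec_Z k c \<phi> a = (\<Sum>M\<in>oriented_dimers k c. \<Prod>e\<in>M. \<phi> e * a (right_face e))"

section \<open>The ratio function\<close>

text \<open>The ratio function at complex weights for which all divisions in the formula make sense.\<close>

definition aztec_Y_domain :: "nat \<Rightarrow> face \<Rightarrow> (dart \<Rightarrow> complex) \<Rightarrow> (face \<Rightarrow> complex) set" where
  "aztec_Y_domain k c \<phi> = {a. (\<forall>f\<in>aztec_faces k c. a f \<noteq> 0) \<and> aztec_Z k c \<phi> a \<noteq> 0}"

definition aztec_Y_complex ::
    "nat \<Rightarrow> face \<Rightarrow> (dart \<Rightarrow> complex) \<Rightarrow> (face \<Rightarrow> complex) \<Rightarrow> complex" where
  "aztec_Y_complex k c \<phi> a =
     (\<Prod>f\<in>aztec_faces k c. a f) * (aztec_Z k c \<phi> (\<lambda>f. inverse (a f)) / aztec_Z k c \<phi> a)"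

text \<open>The diamond of size \<open>0\<close> has no vertices and a single (open) face, its centre.\<close>

lemma aztec_Y_complex_0: "aztec_Y_complex 0 c \<phi> a = a c"
proof -
  have i: "internal_faces 0 c = {}"
    by (auto simp: internal_faces_def)
  have "open_faces 0 c = {c}"
    by (auto simp: open_faces_def prod_eq_iff)
  moreover have "oriented_dimers 0 c = {{}}"
    by (auto simp: oriented_dimers_def aztec_darts_def aztec_vertices_def i)
  ultimately show ?thesis
    by (simp add: aztec_Y_complex_def aztec_faces_def aztec_Z_def i)
qed

text \<open>The polynomial with coefficients \<open>C\<close> in the variables indexed by \<open>F\<close>, of degree at most \<open>\<delta> f\<close>
  in the variable \<open>f\<close>, homogenised in each variable separately and evaluated at
  \<open>[x f : y f]\<close>; for \<open>y = 1\<close> this is its usual value at \<open>x\<close>.\<close>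

definition hom_poly ::
    "'f set \<Rightarrow> ('f \<Rightarrow> nat) \<Rightarrow> (('f \<Rightarrow> nat) \<Rightarrow> complex) \<Rightarrow> ('f \<Rightarrow> complex) \<Rightarrow> ('f \<Rightarrow> complex) \<Rightarrow> complex"
  where
  "hom_poly F \<delta> C x y =
     (\<Sum>m\<in>(\<Pi>\<^sub>E f\<in>F. {..\<delta> f}). C m * (\<Prod>f\<in>F. x f ^ m f * y f ^ (\<delta> f - m f)))"

text \<open>A rational function in the variables indexed by \<open>F\<close> is given by its values \<open>r\<close> on a Zariski-dense
  set \<open>D\<close>. It takes the value \<open>v\<close> at the point \<open>a\<close> of \<open>(CP^1)^F\<close> if it can be written as a fraction
  \<open>P / Q\<close> of polynomials whose homogenisations do not both vanish at \<open>a\<close> and have quotient \<open>v\<close> there.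
  This allows zeros, poles and weights equal to infinity, and leaves the value undefined
  at points of indeterminacy.\<close>

definition ratfun_value ::
    "'f set \<Rightarrow> ('f \<Rightarrow> complex) set \<Rightarrow> (('f \<Rightarrow> complex) \<Rightarrow> complex) \<Rightarrow> ('f \<Rightarrow> riemann_sphere) \<Rightarrow>
      riemann_sphere \<Rightarrow> bool" where
  "ratfun_value F D r a v \<longleftrightarrow>
     (\<exists>\<delta> P Q.
        (\<exists>b. hom_poly F \<delta> Q b (\<lambda>_. 1) \<noteq> 0) \<and>
        (\<forall>b\<in>D. hom_poly F \<delta> P b (\<lambda>_. 1) = r b * hom_poly F \<delta> Q b (\<lambda>_. 1)) \<and>
        (let p = hom_poly F \<delta> P (\<lambda>f. hnum (a f)) (\<lambda>f. hden (a f));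
             q = hom_poly F \<delta> Q (\<lambda>f. hnum (a f)) (\<lambda>f. hden (a f))
         in (p, q) \<noteq> (0, 0) \<and> v = proj_point p q))"

definition aztec_Y_value ::
    "nat \<Rightarrow> face \<Rightarrow> (dart \<Rightarrow> complex) \<Rightarrow> (face \<Rightarrow> riemann_sphere) \<Rightarrow> riemann_sphere \<Rightarrow> bool" where
  "aztec_Y_value k c \<phi> =
     ratfun_value (aztec_faces k c) (aztec_Y_domain k c \<phi>) (aztec_Y_complex k c \<phi>)"

definition aztec_Y_defined ::
    "nat \<Rightarrow> face \<Rightarrow> (dart \<Rightarrow> complex) \<Rightarrow> (face \<Rightarrow> riemann_sphere) \<Rightarrow> bool" where
  "aztec_Y_defined k c \<phi> a \<longleftrightarrow> (\<exists>v. aztec_Y_value k c \<phi> a v)"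

definition aztec_Y ::
    "nat \<Rightarrow> face \<Rightarrow> (dart \<Rightarrow> complex) \<Rightarrow> (face \<Rightarrow> riemann_sphere) \<Rightarrow> riemann_sphere" where
  "aztec_Y k c \<phi> a = (THE v. aztec_Y_value k c \<phi> a v)"

section \<open>Face weights of a discrete holomorphic function\<close>

definition holo_weights :: "(int \<Rightarrow> int \<Rightarrow> riemann_sphere) \<Rightarrow> face \<Rightarrow> riemann_sphere" where
  "holo_weights z f =
     (let i = fst f; j = snd f; s = i + j; r = s mod 2
      in if (i - j) mod 4 \<in> {0, 3}
         then z ((s + r) div 2) ((- s + r) div 2)
         else z ((s + r) div 2) ((- s + r) div 2 + 1))"

end

theory Submission
  imports Defs "HOL-Computational_Algebra.Polynomial"
begin

text \<open>Summing over both directions of an edge gives it the weight \<open>\<phi> (a\<^sub>f - a\<^sub>g)\<close>, where \<open>f\<close>, \<open>g\<close> are the two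
  adjacent faces. Urban renewal at every second face turns the diamond of size \<open>k + 1\<close> into the
  diamond of size \<open>k\<close> with the same Kasteleyn orientation; the weights of these faces are replaced by
  the solution of the dSKP equation at the face and its four neighbours. The equation is invariant
  under \<open>a \<mapsto> 1/a\<close>, and the prefactors for \<open>a\<close> and \<open>1/a\<close> compare in such a way that the ratio function
  is unchanged. Iterating down to size \<open>0\<close> identifies it, at generic weights, with the solution of the
  dSKP recurrence.

  A discrete holomorphic function lifts to a dSKP solution in which four harmonic points are always
  distinct, so every step of the recurrence is nondegenerate there and its value
  depends continuously on the initial weights. Moving along a line from the given weights towards a
  generic point, in homogeneous coordinates, makes both sides polynomial in the parameter; they agree
  off a finite set, hence at \<open>0\<close>.\<close>

section \<open>Dimer sums\<close>

text \<open>Urban renewal is carried out without changing the graph. With the right parity every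
  edge of the larger diamond lies on exactly one active face, so a dimer sum splits into sums over
  single 4-cycles, indexed by assignments of vertices to active faces. Both diamonds become vertex
  sets inside one edge set. The weights of a discrete holomorphic function are too special for this
  argument: adjacent faces may carry equal values, infinity may occur, and intermediate denominators
  may vanish. A value of the ratio function there is given by some fraction \<open>P / Q\<close>,
  known through its agreement with the ratio function where all divisions make sense. Hence the
  comparison is made at generic points of a line and cross-multiplied. The limit determines the
  value because neither pair of homogeneous coordinates, that of the fraction nor that of the
  recurrence, is \<open>(0, 0)\<close> at the end point.\<close>

definition matchings :: "('v \<times> 'v) set \<Rightarrow> 'v set \<Rightarrow> ('v \<times> 'v) set set" where
  "matchings E S =
     {M. M \<subseteq> {e \<in> E. fst e \<in> S \<and> snd e \<in> S} \<and> (\<forall>v\<in>S. \<exists>!e. e \<in> M \<and> (v = fst e \<or> v = snd e))}"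

definition dimer_sum :: "('v \<times> 'v) set \<Rightarrow> 'v set \<Rightarrow> ('v \<times> 'v \<Rightarrow> 'a::comm_semiring_1) \<Rightarrow> 'a" where
  "dimer_sum E S w = (\<Sum>M\<in>matchings E S. \<Prod>e\<in>M. w e)"

lemma matchings_empty: "matchings E {} = {{}}"
  by (auto simp: matchings_def)

lemma dimer_sum_empty: "dimer_sum E {} w = 1"
  by (simp add: dimer_sum_def matchings_empty)

lemma finite_matchings: "finite E \<Longrightarrow> finite (matchings E S)"
  by (rule finite_subset[of _ "Pow E"]) (auto simp: matchings_def)

text \<open>\<open>v\<close> is covered by exactly one edge, and removing this edge with both its
  ends leaves a configuration on the remaining vertices. It serves to evaluate the sums on a
  4-cycle.\<close>

lemma dimer_sum_expand_vertex:
  assumes E: "finite E" and v: "v \<in> S"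
  shows "dimer_sum E S w =
    (\<Sum>e\<in>{e \<in> E. fst e \<in> S \<and> snd e \<in> S \<and> (v = fst e \<or> v = snd e)}.
       w e * dimer_sum E (S - {fst e, snd e}) w)"
proof -
  define I where "I = {e \<in> E. fst e \<in> S \<and> snd e \<in> S \<and> (v = fst e \<or> v = snd e)}"
  define J where "J e = matchings E (S - {fst e, snd e})" for e
  define ev where "ev M = (THE e. e \<in> M \<and> (v = fst e \<or> v = snd e))" for M :: "('a \<times> 'a) set"
  have fin: "finite I" "finite (J e)" for e
    using E by (auto simp: I_def J_def finite_matchings)
  have ev: "ev M \<in> M" "v = fst (ev M) \<or> v = snd (ev M)" if "M \<in> matchings E S" for M
  proof -
    have "\<exists>!e. e \<in> M \<and> (v = fst e \<or> v = snd e)"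
      using that v by (auto simp: matchings_def)
    from theI'[OF this] show "ev M \<in> M" "v = fst (ev M) \<or> v = snd (ev M)"
      unfolding ev_def by auto
  qed
  have uniq: "e = e'" if "M \<in> matchings E S" "e \<in> M" "e' \<in> M" "x = fst e \<or> x = snd e" "x = fst e' \<or> x = snd e'"
    for M e e' x
  proof -
    have "x \<in> S" using that by (auto simp: matchings_def)
    then show ?thesis using that unfolding matchings_def by blast
  qed
  have notin: "e \<notin> M" if "M \<in> J e" for e M
    using that by (auto simp: J_def matchings_def)
  have ins: "insert e M \<in> matchings E S" if "e \<in> I" "M \<in> J e" for e M
  proof -
    have M: "M \<subseteq> {e' \<in> E. fst e' \<in> S - {fst e, snd e} \<and> snd e' \<in> S - {fst e, snd e}}"
      and u: "\<And>v. v \<in> S - {fst e, snd e} \<Longrightarrow> \<exists>!e. e \<in> M \<and> (v = fst e \<or> v = snd e)"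
      using that by (auto simp: J_def matchings_def)
    have "\<exists>!e'. e' \<in> insert e M \<and> (x = fst e' \<or> x = snd e')" if "x \<in> S" for x
    proof (cases "x \<in> {fst e, snd e}")
      case True
      then show ?thesis using M by (intro ex1I[of _ e]) auto
    next
      case False
      then show ?thesis using u[of x] that by auto
    qed
    then show ?thesis using M that by (auto simp: matchings_def I_def)
  qed
  have del: "M - {ev M} \<in> J (ev M)" "ev M \<in> I" if M: "M \<in> matchings E S" for M
  proof -
    show "ev M \<in> I" using ev[OF M] M by (auto simp: I_def matchings_def)
    have sub: "fst e' \<in> S - {fst (ev M), snd (ev M)} \<and> snd e' \<in> S - {fst (ev M), snd (ev M)} \<and> e' \<in> E"
      if "e' \<in> M - {ev M}" for e'
      using that M uniq[OF M, of e' "ev M"] ev(1)[OF M] by (auto simp: matchings_def)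
    have "\<exists>!e. e \<in> M - {ev M} \<and> (x = fst e \<or> x = snd e)" if "x \<in> S - {fst (ev M), snd (ev M)}" for x
    proof -
      have "\<exists>!e. e \<in> M \<and> (x = fst e \<or> x = snd e)" using that M by (auto simp: matchings_def)
      then obtain e where e: "e \<in> M" "x = fst e \<or> x = snd e"
        and u: "\<And>e'. e' \<in> M \<Longrightarrow> x = fst e' \<or> x = snd e' \<Longrightarrow> e' = e"
        unfolding Ex1_def by blast
      have "e \<noteq> ev M" using e that by auto
      then show ?thesis using e u by (intro ex1I[of _ e]) blast+
    qed
    then show "M - {ev M} \<in> J (ev M)" using sub by (auto simp: J_def matchings_def)
  qed
  have ev_ins: "ev (insert e M) = e" if "e \<in> I" "M \<in> J e" for e M
    using uniq[OF ins[OF that], of "ev (insert e M)" e v] ev[OF ins[OF that]] that(1) by (auto simp: I_def)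
  have "dimer_sum E S w = (\<Sum>(e, M)\<in>Sigma I J. w e * (\<Prod>e\<in>M. w e))"
    unfolding dimer_sum_def
  proof (rule sum.reindex_bij_witness[where i = "\<lambda>(e, M). insert e M" and j = "\<lambda>M. (ev M, M - {ev M})"])
    fix M assume M: "M \<in> matchings E S"
    show "(case (ev M, M - {ev M}) of (e, M) \<Rightarrow> insert e M) = M" using ev[OF M] by auto
    show "(ev M, M - {ev M}) \<in> Sigma I J" using del[OF M] by auto
    have "finite M" using M E by (auto simp: matchings_def intro: finite_subset)
    then show "(case (ev M, M - {ev M}) of (e, M) \<Rightarrow> w e * prod w M) = prod w M"
      using ev(1)[OF M] by (simp add: prod.remove)
  next
    fix p assume "p \<in> Sigma I J"
    then obtain e M where p: "p = (e, M)" "e \<in> I" "M \<in> J e" by auto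
    show "(ev (case p of (e, M) \<Rightarrow> insert e M), (case p of (e, M) \<Rightarrow> insert e M) -
        {ev (case p of (e, M) \<Rightarrow> insert e M)}) = p"
      using p ev_ins notin by auto
    show "(case p of (e, M) \<Rightarrow> insert e M) \<in> matchings E S" using p ins by auto
  qed
  also have "\<dots> = (\<Sum>e\<in>I. \<Sum>M\<in>J e. w e * (\<Prod>e\<in>M. w e))"
    using fin by (simp add: sum.Sigma)
  also have "\<dots> = (\<Sum>e\<in>I. w e * dimer_sum E (S - {fst e, snd e}) w)"
    by (simp add: dimer_sum_def J_def sum_distrib_left)
  finally show ?thesis unfolding I_def .
qed

text \<open>The cells \<open>E f\<close> are disjoint, so each vertex belongs to the cell of the
  edge that covers it. This assignment and the matchings inside the cells determine the
  configuration; assignments that leave a cell without a matching contribute zero.\<close>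

theorem dimer_sum_decompose:
  fixes Q :: "'f \<Rightarrow> 'v set" and E :: "'f \<Rightarrow> ('v \<times> 'v) set"
  assumes B: "finite B" and V: "finite V" and E: "\<And>f. f \<in> B \<Longrightarrow> finite (E f)"
    and disj: "\<And>f g. f \<in> B \<Longrightarrow> g \<in> B \<Longrightarrow> f \<noteq> g \<Longrightarrow> E f \<inter> E g = {}"
    and Q: "\<And>f e. f \<in> B \<Longrightarrow> e \<in> E f \<Longrightarrow> fst e \<in> Q f \<and> snd e \<in> Q f"
  shows "dimer_sum (\<Union>f\<in>B. E f) V w =
    (\<Sum>\<sigma>\<in>PiE V (\<lambda>v. {f \<in> B. v \<in> Q f}). \<Prod>f\<in>B. dimer_sum (E f) {v \<in> V. \<sigma> v = f} w)"
proof -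
  let ?E = "\<Union>f\<in>B. E f"
  define \<Sigma> where "\<Sigma> = PiE V (\<lambda>v. {f \<in> B. v \<in> Q f})"
  define T where "T \<sigma> = PiE B (\<lambda>f. matchings (E f) {v \<in> V. \<sigma> v = f})" for \<sigma>
  \<comment> \<open>\<open>ev M v\<close> is the edge of \<open>M\<close> at \<open>v\<close> and
    \<open>fc e\<close> the cell of \<open>e\<close>. The pair \<open>(sg M, sp M)\<close> records
    the assignment and the pieces of \<open>M\<close>; the inverse map takes the union of the
    pieces.\<close>
  define ev where "ev M v = (THE e. e \<in> M \<and> (v = fst e \<or> v = snd e))" for M and v :: 'v
  define fc where "fc e = (THE f. f \<in> B \<and> e \<in> E f)" for e
  define sg where "sg M = restrict (\<lambda>v. fc (ev M v)) V" for M
  define sp where "sp M = restrict (\<lambda>f. M \<inter> E f) B" for M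
  have fin: "finite \<Sigma>" "finite (T \<sigma>)" for \<sigma>
    using B V E by (auto simp: \<Sigma>_def T_def intro!: finite_PiE finite_matchings)
  have fc: "fc e = f" if "f \<in> B" "e \<in> E f" for e f
    unfolding fc_def using that disj by (intro the_equality) auto
  have ev: "ev M v \<in> M" "v = fst (ev M v) \<or> v = snd (ev M v)" if "M \<in> matchings ?E V" "v \<in> V" for M v
  proof -
    have "\<exists>!e. e \<in> M \<and> (v = fst e \<or> v = snd e)"
      using that by (auto simp: matchings_def)
    from theI'[OF this] show "ev M v \<in> M" "v = fst (ev M v) \<or> v = snd (ev M v)"
      unfolding ev_def by auto
  qed
  have ev_eq: "ev M v = e" if "M \<in> matchings ?E V" "e \<in> M" "v = fst e \<or> v = snd e" for M v e
  proof -
    have "v \<in> V" using that by (auto simp: matchings_def)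
    then show ?thesis using that ev[of M v] unfolding matchings_def by blast
  qed
  have sg_in: "sg M \<in> \<Sigma>" if M: "M \<in> matchings ?E V" for M
  proof -
    have "fc (ev M v) \<in> B \<and> v \<in> Q (fc (ev M v))" if v: "v \<in> V" for v
    proof -
      obtain f where "f \<in> B" "ev M v \<in> E f" using ev[OF M v] M by (auto simp: matchings_def)
      then show ?thesis using fc ev(2)[OF M v] Q by metis
    qed
    then show ?thesis by (auto simp: \<Sigma>_def sg_def)
  qed
  have sp_in: "sp M \<in> T (sg M)" if M: "M \<in> matchings ?E V" for M
  proof -
    have "M \<inter> E f \<in> matchings (E f) {v \<in> V. sg M v = f}" if f: "f \<in> B" for f
    proof -
      have 1: "fst e \<in> V" "snd e \<in> V" "sg M (fst e) = f" "sg M (snd e) = f" if "e \<in> M \<inter> E f" for e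
        using that M f ev_eq[OF M, of e "fst e"] ev_eq[OF M, of e "snd e"] fc[of f e]
        by (auto simp: matchings_def sg_def)
      have 2: "\<exists>!e. e \<in> M \<inter> E f \<and> (v = fst e \<or> v = snd e)" if v: "v \<in> V" "sg M v = f" for v
      proof (rule ex1I[of _ "ev M v"])
        obtain g where "g \<in> B" "ev M v \<in> E g" using ev[OF M v(1)] M by (auto simp: matchings_def)
        then show "ev M v \<in> M \<inter> E f \<and> (v = fst (ev M v) \<or> v = snd (ev M v))"
          using ev[OF M v(1)] fc[of g "ev M v"] v by (auto simp: sg_def)
      qed (use ev_eq[OF M] in auto)
      show ?thesis using 1 2 by (auto simp: matchings_def)
    qed
    then show ?thesis by (auto simp: T_def sp_def)
  qed
  have un_in: "(\<Union>f\<in>B. m f) \<in> matchings ?E V" if s: "\<sigma> \<in> \<Sigma>" and m: "m \<in> T \<sigma>" for \<sigma> m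
  proof -
    have mf: "m f \<subseteq> {e \<in> E f. (fst e \<in> V \<and> \<sigma> (fst e) = f) \<and> snd e \<in> V \<and> \<sigma> (snd e) = f}"
      "\<And>v. v \<in> V \<Longrightarrow> \<sigma> v = f \<Longrightarrow> \<exists>!e. e \<in> m f \<and> (v = fst e \<or> v = snd e)" if "f \<in> B" for f
      using m that by (auto simp: T_def matchings_def PiE_iff)
    have "\<exists>!e. e \<in> (\<Union>f\<in>B. m f) \<and> (v = fst e \<or> v = snd e)" if v: "v \<in> V" for v
    proof -
      have sB: "\<sigma> v \<in> B" using s v by (auto simp: \<Sigma>_def)
      obtain e where e: "e \<in> m (\<sigma> v)" "v = fst e \<or> v = snd e"
        and u: "\<And>e'. e' \<in> m (\<sigma> v) \<Longrightarrow> v = fst e' \<or> v = snd e' \<Longrightarrow> e' = e"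
        using mf(2)[OF sB v refl] unfolding Ex1_def by blast
      show ?thesis
      proof (rule ex1I[of _ e])
        show "e \<in> (\<Union>f\<in>B. m f) \<and> (v = fst e \<or> v = snd e)" using e sB by auto
        fix e' assume e': "e' \<in> (\<Union>f\<in>B. m f) \<and> (v = fst e' \<or> v = snd e')"
        then obtain f where f: "f \<in> B" "e' \<in> m f" by auto
        then have "\<sigma> v = f" using mf(1)[OF f(1)] e' by auto
        then show "e' = e" using u f e' by auto
      qed
    qed
    moreover have "(\<Union>f\<in>B. m f) \<subseteq> {e \<in> ?E. fst e \<in> V \<and> snd e \<in> V}"
      using mf(1) by blast
    ultimately show ?thesis by (auto simp: matchings_def)
  qed
  have inv: "sg (\<Union>f\<in>B. m f) = \<sigma>" "sp (\<Union>f\<in>B. m f) = m" if s: "\<sigma> \<in> \<Sigma>" and m: "m \<in> T \<sigma>" for \<sigma> m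
  proof -
    have mf: "m f \<subseteq> {e \<in> E f. (fst e \<in> V \<and> \<sigma> (fst e) = f) \<and> snd e \<in> V \<and> \<sigma> (snd e) = f}"
       if "f \<in> B" for f
      using m that by (auto simp: T_def matchings_def PiE_iff)
    have "fc (ev (\<Union>f\<in>B. m f) v) = \<sigma> v" if v: "v \<in> V" for v
    proof -
      obtain f where f: "f \<in> B" "ev (\<Union>f\<in>B. m f) v \<in> m f"
        using ev(1)[OF un_in[OF s m] v] by auto
      then have "ev (\<Union>f\<in>B. m f) v \<in> E f" "\<sigma> (fst (ev (\<Union>f\<in>B. m f) v)) = f" "\<sigma> (snd (ev (\<Union>f\<in>B. m f) v)) = f"
        using mf[OF f(1)] by blast+
      then show ?thesis using fc[OF f(1)] ev(2)[OF un_in[OF s m] v] by metis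
    qed
    then show "sg (\<Union>f\<in>B. m f) = \<sigma>"
      using s by (auto simp: sg_def \<Sigma>_def fun_eq_iff PiE_iff extensional_def)
    have "(\<Union>f\<in>B. m f) \<inter> E f = m f" if f: "f \<in> B" for f
      using mf f disj by fast
    then show "sp (\<Union>f\<in>B. m f) = m"
      using m by (auto simp: sp_def T_def fun_eq_iff PiE_iff extensional_def)
  qed
  have un_sp: "(\<Union>f\<in>B. sp M f) = M" if "M \<in> matchings ?E V" for M
    using that by (auto simp: sp_def matchings_def)
  have wt: "(\<Prod>e\<in>M. w e) = (\<Prod>f\<in>B. \<Prod>e\<in>sp M f. w e)" if M: "M \<in> matchings ?E V" for M
  proof -
    have "(\<Prod>e\<in>(\<Union>f\<in>B. sp M f). w e) = (\<Prod>f\<in>B. \<Prod>e\<in>sp M f. w e)"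
      by (rule prod.UNION_disjoint) (use B E disj in \<open>auto simp: sp_def\<close>)
    then show ?thesis using un_sp[OF M] by simp
  qed
  have "dimer_sum ?E V w = (\<Sum>(\<sigma>, m)\<in>Sigma \<Sigma> T. \<Prod>f\<in>B. \<Prod>e\<in>m f. w e)"
    unfolding dimer_sum_def
    by (rule sum.reindex_bij_witness[where j = "\<lambda>M. (sg M, sp M)" and i = "\<lambda>(\<sigma>, m). \<Union>f\<in>B. m f"])
       (auto simp: un_sp sg_in sp_in inv un_in wt)
  also have "\<dots> = (\<Sum>\<sigma>\<in>\<Sigma>. \<Sum>m\<in>T \<sigma>. \<Prod>f\<in>B. \<Prod>e\<in>m f. w e)"
    using fin by (simp add: sum.Sigma)
  also have "\<dots> = (\<Sum>\<sigma>\<in>\<Sigma>. \<Prod>f\<in>B. dimer_sum (E f) {v \<in> V. \<sigma> v = f} w)"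
    unfolding T_def dimer_sum_def
    by (intro sum.cong refl prod_sum_PiE[symmetric] B finite_matchings E)
  finally show ?thesis unfolding \<Sigma>_def .
qed

text \<open>Together with the empty set these are the sums for all sixteen corner sets. An odd set
  or a diagonal pair has no matching.\<close>

lemma dimer_sum_4cycle:
  fixes w :: "'v \<times> 'v \<Rightarrow> 'a::comm_semiring_1"
  assumes d: "distinct [A, B, C, D]"
    and E: "E = {(A,B), (B,A), (B,C), (C,B), (C,D), (D,C), (D,A), (A,D)}"
  shows "dimer_sum E {A,B} w = w (A,B) + w (B,A)"
    "dimer_sum E {B,C} w = w (B,C) + w (C,B)"
    "dimer_sum E {C,D} w = w (C,D) + w (D,C)"
    "dimer_sum E {A,D} w = w (D,A) + w (A,D)"
    "dimer_sum E {A,B,C,D} w = (w (A,B) + w (B,A)) * (w (C,D) + w (D,C)) +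
       (w (B,C) + w (C,B)) * (w (D,A) + w (A,D))"
    "dimer_sum E {A} w = 0" "dimer_sum E {B} w = 0" "dimer_sum E {C} w = 0" "dimer_sum E {D} w = 0"
    "dimer_sum E {A,C} w = 0" "dimer_sum E {B,D} w = 0"
    "dimer_sum E {A,B,C} w = 0" "dimer_sum E {B,C,D} w = 0" "dimer_sum E {A,C,D} w = 0" "dimer_sum E {A,B,D} w = 0"
proof -
  have neq: "A \<noteq> B" "A \<noteq> C" "A \<noteq> D" "B \<noteq> C" "B \<noteq> D" "C \<noteq> D"
    "B \<noteq> A" "C \<noteq> A" "D \<noteq> A" "C \<noteq> B" "D \<noteq> B" "D \<noteq> C"
    using d by auto
  have exp: "dimer_sum E S w =
    (\<Sum>e\<in>{(A,B), (B,A), (B,C), (C,B), (C,D), (D,C), (D,A), (A,D)}.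
      if fst e \<in> S \<and> snd e \<in> S \<and> (v = fst e \<or> v = snd e) then w e * dimer_sum E (S - {fst e, snd e}) w else 0)"
    if "v \<in> S" for v S
  proof -
    have "finite E" by (simp add: E)
    then show ?thesis
      unfolding E[symmetric] by (simp only: dimer_sum_expand_vertex[of E v S] that sum.inter_filter)
  qed
  note [simp] = neq dimer_sum_empty insert_Diff_if
  show 1: "dimer_sum E {A} w = 0" "dimer_sum E {B} w = 0" "dimer_sum E {C} w = 0" "dimer_sum E {D} w = 0"
    by (simp_all add: exp[of A "{A}"] exp[of B "{B}"] exp[of C "{C}"] exp[of D "{D}"])
  show "dimer_sum E {A,C} w = 0" "dimer_sum E {B,D} w = 0"
    by (simp_all add: exp[of A "{A,C}"] exp[of B "{B,D}"])
  show "dimer_sum E {A,B} w = w (A,B) + w (B,A)" by (simp add: exp[of A "{A,B}"])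
  show 2: "dimer_sum E {B,C} w = w (B,C) + w (C,B)" by (simp add: exp[of B "{B,C}"])
  show 3: "dimer_sum E {C,D} w = w (C,D) + w (D,C)" by (simp add: exp[of C "{C,D}"])
  show "dimer_sum E {A,D} w = w (D,A) + w (A,D)" by (simp add: exp[of A "{A,D}"])
  show "dimer_sum E {A,B,C} w = 0" by (simp add: exp[of A "{A,B,C}"] 1)
  show "dimer_sum E {B,C,D} w = 0" by (simp add: exp[of B "{B,C,D}"] 1)
  show "dimer_sum E {A,C,D} w = 0" by (simp add: exp[of A "{A,C,D}"] 1)
  show "dimer_sum E {A,B,D} w = 0" by (simp add: exp[of A "{A,B,D}"] 1)
  show "dimer_sum E {A,B,C,D} w = (w (A,B) + w (B,A)) * (w (C,D) + w (D,C)) +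
       (w (B,C) + w (C,B)) * (w (D,A) + w (A,D))"
    by (simp add: exp[of A "{A,B,C,D}"] 2 3 algebra_simps)
qed

section \<open>The local move\<close>

definition upd_den :: "'a::comm_ring_1 \<Rightarrow> 'a \<Rightarrow> 'a \<Rightarrow> 'a \<Rightarrow> 'a \<Rightarrow> 'a" where
  "upd_den x n e s w = x * (e + w - n - s) + n * s - e * w"

definition upd_num :: "'a::comm_ring_1 \<Rightarrow> 'a \<Rightarrow> 'a \<Rightarrow> 'a \<Rightarrow> 'a \<Rightarrow> 'a" where
  "upd_num x n e s w = x * (e * w - n * s) + n * s * (e + w) - e * w * (n + s)"

text \<open>\<open>upd_num / upd_den\<close> is the solution \<open>y\<close> of the dSKP equation
  \<open>(x - n) (w - y) (s - e) = - (n - w) (y - s) (e - x)\<close>. The face weights \<open>n, e, s, w\<close> surround \<open>x\<close>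
  in the north, east, south and west.\<close>

definition face_den :: "(face \<Rightarrow> complex) \<Rightarrow> face \<Rightarrow> complex" where
  "face_den a f = upd_den (a f) (a (fst f, snd f + 1)) (a (fst f + 1, snd f)) (a (fst f, snd f - 1)) (a (fst f - 1, snd f))"

definition face_num :: "(face \<Rightarrow> complex) \<Rightarrow> face \<Rightarrow> complex" where
  "face_num a f = upd_num (a f) (a (fst f, snd f + 1)) (a (fst f + 1, snd f)) (a (fst f, snd f - 1)) (a (fst f - 1, snd f))"

definition dart_weight :: "(dart \<Rightarrow> complex) \<Rightarrow> (face \<Rightarrow> complex) \<Rightarrow> dart \<Rightarrow> complex" where
  "dart_weight \<phi> a e = \<phi> e * a (right_face e)"

text \<open>The gauge factor of a vertex under the local move at the faces \<open>f\<close> with \<open>fst f + snd f + r\<close> even.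
  Seen from such a face it is \<open>(-1) ^ fst f\<close> divided by the weight of the vertical neighbour minus
  that of the horizontal neighbour at the vertex. Both sign changes cancel between the two such faces
  at a vertex, so it does not depend on the face.\<close>

definition vertex_factor :: "int \<Rightarrow> (face \<Rightarrow> complex) \<Rightarrow> vertex \<Rightarrow> complex" where
  "vertex_factor r a v =
     (if even (fst v) then 1 else -1) /
     (if even (fst v + snd v + r) then a (fst v, snd v + 1) - a (fst v + 1, snd v)
      else a v - a (fst v + 1, snd v + 1))"

definition face_sign :: "(dart \<Rightarrow> complex) \<Rightarrow> face \<Rightarrow> complex" where
  "face_sign \<phi> f = \<phi> ((fst f - 1, snd f), f) * \<phi> ((fst f, snd f - 1), (fst f - 1, snd f - 1))"

definition kasteleyn_face :: "(dart \<Rightarrow> complex) \<Rightarrow> face \<Rightarrow> bool" where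
  "kasteleyn_face \<phi> f \<longleftrightarrow>
     (\<forall>(v, w)\<in>face_darts f. \<phi> (v, w) \<in> {-1, 1} \<and> \<phi> (w, v) = - \<phi> (v, w)) \<and>
     (\<Prod>e\<in>{e \<in> face_darts f. white (fst e)}. \<phi> e) = -1"

lemma face_darts_eq:
  "face_darts (x, y) =
     {((x - 1, y), (x, y)), ((x, y), (x - 1, y)), ((x, y), (x, y - 1)), ((x, y - 1), (x, y)),
      ((x, y - 1), (x - 1, y - 1)), ((x - 1, y - 1), (x, y - 1)),
      ((x - 1, y - 1), (x - 1, y)), ((x - 1, y), (x - 1, y - 1))}"
  (is "_ = ?R")
proof (intro equalityI subsetI)
  fix e assume e: "e \<in> face_darts (x, y)"
  obtain p q p' q' where pq: "e = ((p, q), (p', q'))" by (metis prod.exhaust)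
  have "p = x - 1 \<or> p = x" "p' = x - 1 \<or> p' = x" "q = y - 1 \<or> q = y" "q' = y - 1 \<or> q' = y"
    "\<bar>p - p'\<bar> + \<bar>q - q'\<bar> = 1"
    using e unfolding pq face_darts_def face_corners_def adjacent_def mem_Collect_eq prod.case mem_Times_iff
      fst_conv snd_conv insert_iff empty_iff by blast+
  then show "e \<in> ?R" unfolding pq by (elim disjE) simp_all
next
  fix e assume "e \<in> ?R"
  then show "e \<in> face_darts (x, y)"
    unfolding insert_iff empty_iff
    by (elim disjE; simp add: face_darts_def face_corners_def adjacent_def)
qed

lemma face_corners_eq: "face_corners (x, y) = {(x - 1, y), (x, y), (x, y - 1), (x - 1, y - 1)}"
  unfolding face_corners_def fst_conv snd_conv by blast

lemma kasteleyn_faceD: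
  assumes "kasteleyn_face \<phi> f" "(v, w) \<in> face_darts f"
  shows "\<phi> (v, w) \<in> {-1, 1}" "\<phi> (w, v) = - \<phi> (v, w)"
  using bspec[OF conjunct1[OF assms(1)[unfolded kasteleyn_face_def]] assms(2)] unfolding prod.case
  by (rule conjunct1, rule conjunct2)

text \<open>Passing from the white-to-black darts to the cyclically directed ones reverses two of
  the four, so the product stays \<open>-1\<close> for either colouring of the corners.\<close>

lemma kasteleyn_face_product:
  assumes "kasteleyn_face \<phi> (x, y)"
  shows "\<phi> ((x - 1, y), (x, y)) * \<phi> ((x, y), (x, y - 1)) * \<phi> ((x, y - 1), (x - 1, y - 1)) *
    \<phi> ((x - 1, y - 1), (x - 1, y)) = -1"
proof -
  note sk = kasteleyn_faceD(2)[OF assms]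
  show ?thesis
  proof (cases "even (x + y)")
    case True
    then have "{e \<in> face_darts (x, y). white (fst e)} =
        {((x, y), (x - 1, y)), ((x, y), (x, y - 1)), ((x - 1, y - 1), (x, y - 1)), ((x - 1, y - 1), (x - 1, y))}"
      by (auto simp: face_darts_eq white_def)
    then have "\<phi> ((x, y), (x - 1, y)) * \<phi> ((x, y), (x, y - 1)) * \<phi> ((x - 1, y - 1), (x, y - 1)) * \<phi> ((x - 1, y - 1), (x - 1, y)) = -1"
      using assms by (simp add: kasteleyn_face_def mult.assoc)
    then show ?thesis
      by (simp add: sk[of "(x, y)" "(x - 1, y)"] sk[of "(x - 1, y - 1)" "(x, y - 1)"] face_darts_eq)
  next
    case False
    then have "{e \<in> face_darts (x, y). white (fst e)} =
        {((x - 1, y), (x, y)), ((x - 1, y), (x - 1, y - 1)), ((x, y - 1), (x, y)), ((x, y - 1), (x - 1, y - 1))}"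
      by (auto simp: face_darts_eq white_def)
    then have "\<phi> ((x - 1, y), (x, y)) * \<phi> ((x - 1, y), (x - 1, y - 1)) * \<phi> ((x, y - 1), (x, y)) * \<phi> ((x, y - 1), (x - 1, y - 1)) = -1"
      using assms by (simp add: kasteleyn_face_def mult.assoc)
    then show ?thesis
      by (simp add: sk[of "(x - 1, y - 1)" "(x - 1, y)"] sk[of "(x, y)" "(x, y - 1)"] face_darts_eq mult_ac)
  qed
qed

text \<open>\<open>upd_den x n e s w\<close> equals (x - n) (x - s) - (x - e) (x - w). The
  hypothesis is linear in \<open>y\<close>, so the denominator times \<open>y - z\<close> is a
  polynomial in the old weights and \<open>z\<close>, and it factors when \<open>z\<close> is a
  neighbour.\<close>

lemma upd_identities:
  fixes x y n e s w :: "'a::comm_ring_1"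
  assumes "y * upd_den x n e s w = upd_num x n e s w"
  shows "upd_den x n e s w * (y - n) = (x - s) * ((n - w) * (n - e))"
    "upd_den x n e s w * (y - s) = (x - n) * ((s - w) * (s - e))"
    "upd_den x n e s w * (y - e) = - ((x - w) * ((n - e) * (s - e)))"
    "upd_den x n e s w * (y - w) = - ((x - e) * ((n - w) * (s - w)))"
    "upd_den x n e s w * upd_den y n e s w = (n - w) * (n - e) * (s - e) * (s - w)"
proof -
  have 1: "upd_den x n e s w * (y - z) = upd_num x n e s w - upd_den x n e s w * z" for z
    using assms by (simp add: algebra_simps)
  show "upd_den x n e s w * (y - n) = (x - s) * ((n - w) * (n - e))"
    "upd_den x n e s w * (y - s) = (x - n) * ((s - w) * (s - e))"
    "upd_den x n e s w * (y - e) = - ((x - w) * ((n - e) * (s - e)))"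
    "upd_den x n e s w * (y - w) = - ((x - e) * ((n - w) * (s - w)))"
    unfolding 1 by (simp_all add: upd_num_def upd_den_def algebra_simps)
  have "upd_den x n e s w * upd_den y n e s w =
      (y * upd_den x n e s w) * (e + w - n - s) + (n * s - e * w) * upd_den x n e s w"
    unfolding upd_den_def[of y] by (simp add: algebra_simps)
  also have "\<dots> = (n - w) * (n - e) * (s - e) * (s - w)"
    unfolding assms by (simp add: upd_num_def upd_den_def algebra_simps)
  finally show "upd_den x n e s w * upd_den y n e s w = (n - w) * (n - e) * (s - e) * (s - w)" .
qed

text \<open>\<open>N\<close>, \<open>E\<close>, \<open>S\<close>, \<open>W\<close> are the signs of
  the sides, \<open>lA\<close> to \<open>lD\<close> the gauge factors of the corners.
  \<open>\<kappa>\<close> is the sum over both matchings of the full square before the move; the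
  other identities pair each side with the opposite side after the move, and the empty square with
  the full one.\<close>

lemma local_algebra:
  fixes x y n e s w N E S W lA lB lC lD \<epsilon> :: "'a::field"
  assumes y: "y * upd_den x n e s w = upd_num x n e s w"
    and sq: "N * N = 1" "E * E = 1" "S * S = 1" "W * W = 1" "N * E * S * W = -1"
    and ne: "n \<noteq> e" "n \<noteq> w" "s \<noteq> e" "s \<noteq> w"
    and \<epsilon>: "\<epsilon> * \<epsilon> = 1"
    and l: "lA = \<epsilon> / (n - w)" "lB = \<epsilon> / (n - e)" "lC = \<epsilon> / (s - e)" "lD = \<epsilon> / (s - w)"
  defines "\<kappa> \<equiv> N * S * upd_den x n e s w"
  shows "N * (x - n) * (S * (x - s)) + E * (x - e) * (W * (x - w)) = \<kappa>"
    "\<kappa> * (lA * lB) * (N * (y - n)) = S * (x - s)"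
    "\<kappa> * (lC * lD) * (S * (y - s)) = N * (x - n)"
    "\<kappa> * (lB * lC) * (E * (y - e)) = W * (x - w)"
    "\<kappa> * (lA * lD) * (W * (y - w)) = E * (x - e)"
    "\<kappa> * (lA * lB * lC * lD) * (N * (y - n) * (S * (y - s)) + E * (y - e) * (W * (y - w))) = 1"
proof -
  note u = upd_identities[OF y]
  \<comment> \<open>The Kasteleyn sign turns the sum of the two matchings into the difference of
    products that is \<open>upd_den\<close>.\<close>
  have EW: "E * W = - (N * S)"
  proof -
    have "(N * N) * (S * S) * (E * W) = (N * E * S * W) * (N * S)" by (simp add: algebra_simps)
    then show ?thesis by (simp add: sq)
  qed
  have NSE: "N * S * E = - W" 
  proof -
    have "N * S * E = (N * E * S * W) * W" using sq(4) by (simp add: algebra_simps)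
    then show ?thesis by (simp add: sq)
  qed
  have NSW: "N * S * W = - E" 
  proof -
    have "N * S * W = (N * E * S * W) * E" using sq(2) by (simp add: algebra_simps)
    then show ?thesis by (simp add: sq)
  qed
  have all: "N * (z - n) * (S * (z - s)) + E * (z - e) * (W * (z - w)) = N * S * upd_den z n e s w" for z
  proof -
    have "N * (z - n) * (S * (z - s)) + E * (z - e) * (W * (z - w)) =
        (N * S) * ((z - n) * (z - s)) + (E * W) * ((z - e) * (z - w))" by (simp add: algebra_simps)
    then show ?thesis by (simp add: EW upd_den_def algebra_simps)
  qed
  show "N * (x - n) * (S * (x - s)) + E * (x - e) * (W * (x - w)) = \<kappa>"
    by (simp add: all \<kappa>_def)
  \<comment> \<open>Each product contains \<open>\<epsilon>\<close> twice, so no sign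
    survives.\<close>
  have ll: "lA * lB * ((n - w) * (n - e)) = 1" "lC * lD * ((s - w) * (s - e)) = 1"
      "lB * lC * ((n - e) * (s - e)) = 1" "lA * lD * ((n - w) * (s - w)) = 1"
  proof -
    have c: "\<epsilon> / a * (\<epsilon> / b) * (a * b) = 1" if "a \<noteq> 0" "b \<noteq> 0" for a b
      using that \<epsilon> by (simp add: field_simps)
    show "lA * lB * ((n - w) * (n - e)) = 1" "lC * lD * ((s - w) * (s - e)) = 1"
      "lB * lC * ((n - e) * (s - e)) = 1" "lA * lD * ((n - w) * (s - w)) = 1"
      unfolding l using ne c[of "n - w" "n - e"] c[of "s - e" "s - w"] c[of "n - e" "s - e"] c[of "n - w" "s - w"]
      by (simp_all add: mult.commute)
  qed
  have "\<kappa> * (lA * lB) * (N * (y - n)) = (N * N) * S * (lA * lB) * (upd_den x n e s w * (y - n))"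
    by (simp add: \<kappa>_def algebra_simps)
  also have "\<dots> = S * (x - s) * (lA * lB * ((n - w) * (n - e)))" by (simp only: sq u) (simp add: algebra_simps)
  finally show "\<kappa> * (lA * lB) * (N * (y - n)) = S * (x - s)" unfolding ll by simp
  have "\<kappa> * (lC * lD) * (S * (y - s)) = (S * S) * N * (lC * lD) * (upd_den x n e s w * (y - s))"
    by (simp add: \<kappa>_def algebra_simps)
  also have "\<dots> = N * (x - n) * (lC * lD * ((s - w) * (s - e)))" by (simp only: sq u) (simp add: algebra_simps)
  finally show "\<kappa> * (lC * lD) * (S * (y - s)) = N * (x - n)" unfolding ll by simp
  have "\<kappa> * (lB * lC) * (E * (y - e)) = (N * S * E) * (lB * lC) * (upd_den x n e s w * (y - e))"
    by (simp add: \<kappa>_def algebra_simps)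
  also have "\<dots> = W * (x - w) * (lB * lC * ((n - e) * (s - e)))" by (simp only: NSE u) (simp add: algebra_simps)
  finally show "\<kappa> * (lB * lC) * (E * (y - e)) = W * (x - w)" unfolding ll by simp
  have "\<kappa> * (lA * lD) * (W * (y - w)) = (N * S * W) * (lA * lD) * (upd_den x n e s w * (y - w))"
    by (simp add: \<kappa>_def algebra_simps)
  also have "\<dots> = E * (x - e) * (lA * lD * ((n - w) * (s - w)))" by (simp only: NSW u) (simp add: algebra_simps)
  finally show "\<kappa> * (lA * lD) * (W * (y - w)) = E * (x - e)" unfolding ll by simp
  have "\<kappa> * (lA * lB * lC * lD) * (N * (y - n) * (S * (y - s)) + E * (y - e) * (W * (y - w))) =
      (N * N) * (S * S) * (lA * lB * (lC * lD)) * (upd_den x n e s w * upd_den y n e s w)"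
    unfolding all by (simp add: \<kappa>_def algebra_simps)
  also have "\<dots> = (lA * lB * ((n - w) * (n - e))) * (lC * lD * ((s - w) * (s - e)))"
    by (simp only: sq u mult_1 mult_ac)
  finally show "\<kappa> * (lA * lB * lC * lD) * (N * (y - n) * (S * (y - s)) + E * (y - e) * (W * (y - w))) = 1"
    unfolding ll by simp
qed

text \<open>A check of all sixteen corner sets. Odd sets have odd complements and the two diagonals
  are complementary, so there zero meets zero; the four sides, the full and the empty set are the
  identities of \<open>local_algebra\<close>.\<close>

lemma local_move:
  assumes K: "kasteleyn_face \<phi> f"
    and act: "even (fst f + snd f + r)"
    and y: "a' f * face_den a f = face_num a f"
    and ne: "a (fst f, snd f + 1) \<noteq> a (fst f + 1, snd f)" "a (fst f, snd f + 1) \<noteq> a (fst f - 1, snd f)"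
      "a (fst f, snd f - 1) \<noteq> a (fst f + 1, snd f)" "a (fst f, snd f - 1) \<noteq> a (fst f - 1, snd f)"
    and a': "\<And>g. odd (fst g + snd g + r) \<Longrightarrow> a' g = a g"
    and T: "T \<subseteq> face_corners f"
  shows "dimer_sum (face_darts f) T (dart_weight \<phi> a) =
    face_sign \<phi> f * face_den a f * (\<Prod>v\<in>face_corners f - T. vertex_factor r a v) *
    dimer_sum (face_darts f) (face_corners f - T) (dart_weight \<phi> a')"
proof -
  obtain p q where f: "f = (p, q)" by (cases f)
  define A B C D where "A = (p - 1, q)" and "B = (p, q)" and "C = (p, q - 1)" and "D = (p - 1, q - 1)"
  note ABCD = A_def B_def C_def D_def
  have dist: "distinct [A, B, C, D]" by (simp add: ABCD)
  have E: "face_darts f = {(A,B), (B,A), (B,C), (C,B), (C,D), (D,C), (D,A), (A,D)}"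
    by (simp add: f face_darts_eq ABCD)
  have cor: "face_corners f = {A, B, C, D}"
    by (simp add: f face_corners_eq ABCD)
  define N E S W where "N = \<phi> (A, B)" and "E = \<phi> (B, C)" and "S = \<phi> (C, D)" and "W = \<phi> (D, A)"
  define x n e s w where "x = a f" and "n = a (p, q + 1)" and "e = a (p + 1, q)" and "s = a (p, q - 1)" and "w = a (p - 1, q)"
  define \<epsilon> :: complex where "\<epsilon> = (if even p then 1 else -1)"
  have sk: "\<phi> (A, B) \<in> {-1, 1}" "\<phi> (B, C) \<in> {-1, 1}" "\<phi> (C, D) \<in> {-1, 1}" "\<phi> (D, A) \<in> {-1, 1}"
    "\<phi> (B, A) = - N" "\<phi> (C, B) = - E" "\<phi> (D, C) = - S" "\<phi> (A, D) = - W"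
    unfolding N_def E_def S_def W_def by (rule kasteleyn_faceD[OF K]; simp add: E)+
  have sq: "N * N = 1" "E * E = 1" "S * S = 1" "W * W = 1"
    using sk(1-4) by (auto simp: N_def E_def S_def W_def)
  have NESW: "N * E * S * W = -1"
    using kasteleyn_face_product[of \<phi> p q] K by (simp add: f N_def E_def S_def W_def ABCD)
  have fd: "face_den a f = upd_den x n e s w" "face_num a f = upd_num x n e s w"
    by (simp_all add: face_den_def face_num_def f x_def n_def e_def s_def w_def)
  have l: "vertex_factor r a A = \<epsilon> / (n - w)" "vertex_factor r a B = \<epsilon> / (n - e)"
     "vertex_factor r a C = \<epsilon> / (s - e)" "vertex_factor r a D = \<epsilon> / (s - w)"
  proof -
    show "vertex_factor r a B = \<epsilon> / (n - e)"
      using act by (auto simp: vertex_factor_def B_def f \<epsilon>_def n_def e_def)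
    show "vertex_factor r a C = \<epsilon> / (s - e)"
      using act by (auto simp: vertex_factor_def C_def f \<epsilon>_def s_def e_def)
    show "vertex_factor r a A = \<epsilon> / (n - w)"
      using act ne by (auto simp: vertex_factor_def A_def f \<epsilon>_def n_def w_def divide_simps)
    show "vertex_factor r a D = \<epsilon> / (s - w)"
      using act ne by (auto simp: vertex_factor_def D_def f \<epsilon>_def s_def w_def divide_simps)
  qed
  have rf: "right_face (A,B) = (p,q)" "right_face (B,A) = (p,q+1)" "right_face (B,C) = (p,q)" "right_face (C,B) = (p+1,q)"
    "right_face (C,D) = (p,q)" "right_face (D,C) = (p,q-1)" "right_face (D,A) = (p,q)" "right_face (A,D) = (p-1,q)"
    by (simp_all add: ABCD right_face_def Let_def)
  have wt: "dart_weight \<phi> b (A,B) + dart_weight \<phi> b (B,A) = N * (b (p,q) - b (p,q+1))"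
    "dart_weight \<phi> b (B,C) + dart_weight \<phi> b (C,B) = E * (b (p,q) - b (p+1,q))"
    "dart_weight \<phi> b (C,D) + dart_weight \<phi> b (D,C) = S * (b (p,q) - b (p,q-1))"
    "dart_weight \<phi> b (D,A) + dart_weight \<phi> b (A,D) = W * (b (p,q) - b (p-1,q))" for b
    unfolding dart_weight_def rf sk using N_def E_def S_def W_def by (simp_all add: algebra_simps)
  have a'n: "a' (p,q+1) = n" "a' (p+1,q) = e" "a' (p,q-1) = s" "a' (p-1,q) = w"
    using act by (auto simp: f n_def e_def s_def w_def intro!: a')
  note nes = ne[unfolded f fst_conv snd_conv, folded n_def e_def s_def w_def]
  have \<epsilon>: "\<epsilon> * \<epsilon> = 1" by (simp add: \<epsilon>_def)
  note alg = local_algebra[OF y[unfolded fd] sq NESW nes \<epsilon> l]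
  have fs: "face_sign \<phi> f = N * S" by (simp add: face_sign_def f N_def S_def ABCD)
  note sums = dimer_sum_4cycle[OF dist E]
  have neq: "A \<noteq> B" "A \<noteq> C" "A \<noteq> D" "B \<noteq> C" "B \<noteq> D" "C \<noteq> D"
    "B \<noteq> A" "C \<noteq> A" "D \<noteq> A" "C \<noteq> B" "D \<noteq> B" "D \<noteq> C"
    using dist by auto
  have xx: "a (p, q) = x" "a (p, q + 1) = n" "a (p + 1, q) = e" "a (p, q - 1) = s" "a (p - 1, q) = w"
    by (simp_all add: x_def f n_def e_def s_def w_def)
  have yy: "a' (p, q) = a' f" by (simp add: f)
  obtain a1 a2 a3 a4 where "T = (if a1 then {A} else {}) \<union> (if a2 then {B} else {}) \<union>
      (if a3 then {C} else {}) \<union> (if a4 then {D} else {})"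
  proof
    show "T = (if A \<in> T then {A} else {}) \<union> (if B \<in> T then {B} else {}) \<union>
      (if C \<in> T then {C} else {}) \<union> (if D \<in> T then {D} else {})"
      using T unfolding cor by (auto split: if_splits)
  qed
  then show ?thesis
    by (cases a1; cases a2; cases a3; cases a4; simp only: if_True if_False Un_insert_left Un_empty_left Un_empty_right cor;
      simp add: neq insert_Diff_if sums wt dimer_sum_empty alg[unfolded mult.assoc] fs fd xx yy a'n mult.assoc)
qed

section \<open>Urban renewal on the Aztec diamond\<close>

lemma finite_aztec_faces: "finite (aztec_faces k c)"
proof (rule finite_subset)
  show "aztec_faces k c \<subseteq> {fst c - int k..fst c + int k} \<times> {snd c - int k..snd c + int k}"
    by (auto simp: aztec_faces_def internal_faces_def open_faces_def)
qed auto

lemma finite_internal_faces: "finite (internal_faces k c)"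
  using finite_aztec_faces[of k c] by (simp add: aztec_faces_def)

lemma finite_face_darts: "finite (face_darts f)"
  by (cases f) (simp add: face_darts_eq)

lemma mem_face_corners:
  "v \<in> face_corners f \<longleftrightarrow> (fst v = fst f - 1 \<or> fst v = fst f) \<and> (snd v = snd f - 1 \<or> snd v = snd f)"
  unfolding face_corners_def mem_Times_iff by blast

text \<open>Vertices sit at half-integers, so \<open>2 * (fst v - c) + 1\<close> is twice the offset
  of \<open>v\<close>; doubling keeps the estimates integral.\<close>

lemma face_corners_dist:
  fixes c :: int
  assumes "v \<in> face_corners f"
  shows "\<bar>2 * (fst v - c) + 1\<bar> \<le> 2 * \<bar>fst f - c\<bar> + 1" "2 * \<bar>fst f - c\<bar> \<le> \<bar>2 * (fst v - c) + 1\<bar> + 1"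
    "\<bar>2 * (snd v - c) + 1\<bar> \<le> 2 * \<bar>snd f - c\<bar> + 1" "2 * \<bar>snd f - c\<bar> \<le> \<bar>2 * (snd v - c) + 1\<bar> + 1"
proof -
  have "fst v = fst f - 1 \<or> fst v = fst f"
    using assms unfolding mem_face_corners by blast
  then show "\<bar>2 * (fst v - c) + 1\<bar> \<le> 2 * \<bar>fst f - c\<bar> + 1" "2 * \<bar>fst f - c\<bar> \<le> \<bar>2 * (fst v - c) + 1\<bar> + 1"
    by smt+
  have "snd v = snd f - 1 \<or> snd v = snd f"
    using assms unfolding mem_face_corners by blast
  then show "\<bar>2 * (snd v - c) + 1\<bar> \<le> 2 * \<bar>snd f - c\<bar> + 1" "2 * \<bar>snd f - c\<bar> \<le> \<bar>2 * (snd v - c) + 1\<bar> + 1"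
    by smt+
qed

text \<open>Passing from a face to a corner adds at most one to the distance from the centre.
  Conversely, the incident face nearest to the centre is one unit closer than the vertex.\<close>

lemma mem_aztec_vertices:
  "v \<in> aztec_vertices k c \<longleftrightarrow> \<bar>2 * (fst v - fst c) + 1\<bar> + \<bar>2 * (snd v - snd c) + 1\<bar> \<le> 2 * int k"
proof
  assume "v \<in> aztec_vertices k c"
  then obtain f where "\<bar>fst f - fst c\<bar> + \<bar>snd f - snd c\<bar> < int k" "v \<in> face_corners f"
    unfolding aztec_vertices_def internal_faces_def by blast
  then show "\<bar>2 * (fst v - fst c) + 1\<bar> + \<bar>2 * (snd v - snd c) + 1\<bar> \<le> 2 * int k"
    using face_corners_dist(1)[of v f "fst c"] face_corners_dist(3)[of v f "snd c"] by smt
next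
  assume *: "\<bar>2 * (fst v - fst c) + 1\<bar> + \<bar>2 * (snd v - snd c) + 1\<bar> \<le> 2 * int k"
  define f where "f = (if fst v \<ge> fst c then fst v else fst v + 1, if snd v \<ge> snd c then snd v else snd v + 1)"
  have "\<bar>fst f - fst c\<bar> + \<bar>snd f - snd c\<bar> < int k"
    using * by (simp add: f_def) linarith
  moreover have "v \<in> face_corners f" by (simp add: mem_face_corners f_def)
  ultimately show "v \<in> aztec_vertices k c"
    unfolding aztec_vertices_def internal_faces_def by blast
qed

lemma aztec_vertices_mono: "aztec_vertices k c \<subseteq> aztec_vertices (Suc k) c"
  unfolding subset_iff mem_aztec_vertices by auto

lemma finite_aztec_vertices: "finite (aztec_vertices k c)"
  unfolding aztec_vertices_def by (auto simp: finite_internal_faces face_corners_def)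

text \<open>An edge with both ends in the diamond borders an internal face, namely the one on its
  side towards the centre. Being induced, a diamond is fixed by its vertices, which allows two sizes
  to share one edge set.\<close>

lemma aztec_darts_induced:
  "aztec_darts k c = {e. adjacent (fst e) (snd e) \<and> fst e \<in> aztec_vertices k c \<and> snd e \<in> aztec_vertices k c}"
proof (intro equalityI subsetI)
  fix e assume "e \<in> aztec_darts k c"
  then show "e \<in> {e. adjacent (fst e) (snd e) \<and> fst e \<in> aztec_vertices k c \<and> snd e \<in> aztec_vertices k c}"
    unfolding aztec_darts_def aztec_vertices_def face_darts_def by auto
next
  fix e assume e: "e \<in> {e. adjacent (fst e) (snd e) \<and> fst e \<in> aztec_vertices k c \<and> snd e \<in> aztec_vertices k c}"
  obtain v w where vw: "e = (v, w)" by (cases e)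
  have adj: "\<bar>fst v - fst w\<bar> + \<bar>snd v - snd w\<bar> = 1"
    and inV: "\<bar>2 * (fst v - fst c) + 1\<bar> + \<bar>2 * (snd v - snd c) + 1\<bar> \<le> 2 * int k"
      "\<bar>2 * (fst w - fst c) + 1\<bar> + \<bar>2 * (snd w - snd c) + 1\<bar> \<le> 2 * int k"
    using e by (simp_all add: vw adjacent_def mem_aztec_vertices)
  define f where "f =
    (if snd v = snd w then (max (fst v) (fst w), if snd v \<ge> snd c then snd v else snd v + 1)
     else (if fst v \<ge> fst c then fst v else fst v + 1, max (snd v) (snd w)))"
  have "\<bar>fst f - fst c\<bar> + \<bar>snd f - snd c\<bar> < int k \<and> v \<in> face_corners f \<and> w \<in> face_corners f"
  proof (cases "snd v = snd w")
    case True
    then have "fst w = fst v + 1 \<or> fst v = fst w + 1" using adj by linarith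
    then show ?thesis
      using True inV unfolding mem_face_corners f_def by (elim disjE; cases "snd v \<ge> snd c"; simp; linarith)
  next
    case False
    then have "fst v = fst w" "snd w = snd v + 1 \<or> snd v = snd w + 1" using adj by linarith+
    then show ?thesis
      using False inV unfolding mem_face_corners f_def by (elim disjE; cases "fst v \<ge> fst c"; simp; linarith)
  qed
  then show "e \<in> aztec_darts k c"
    using e unfolding aztec_darts_def vw
    by (intro UN_I[of f]) (auto simp: internal_faces_def face_darts_def)
qed

text \<open>\<open>r\<close> selects one colour of the checkerboard of faces. In the iteration it is
  the number of the step, so the colours alternate.\<close>

definition active :: "int \<Rightarrow> nat \<Rightarrow> face \<Rightarrow> face set" where
  "active r k c = {f \<in> internal_faces k c. even (fst f + snd f + r)}"

lemma finite_active: "finite (active r k c)"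
  by (simp add: active_def finite_internal_faces)

lemma active_face_darts_disjoint:
  assumes "even (fst f + snd f + r)" "even (fst g + snd g + r)" "f \<noteq> g"
  shows "face_darts f \<inter> face_darts g = {}"
proof (rule ccontr)
  assume "face_darts f \<inter> face_darts g \<noteq> {}"
  then obtain v w where v: "v \<in> face_corners f" "v \<in> face_corners g" and w: "w \<in> face_corners f" "w \<in> face_corners g"
    and "adjacent v w"
    unfolding face_darts_def by blast
  then have ne: "fst v \<noteq> fst w \<or> snd v \<noteq> snd w" by (auto simp: adjacent_def)
  have "fst f = fst g \<or> snd f = snd g" 
    using v w ne unfolding mem_face_corners by linarith
  moreover have "\<bar>fst f - fst g\<bar> \<le> 1" "\<bar>snd f - snd g\<bar> \<le> 1"
    using v unfolding mem_face_corners by linarith+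
  moreover have "even ((fst f - fst g) + (snd f - snd g))"
    using assms(1,2) by auto
  ultimately have "fst f = fst g \<and> snd f = snd g" by presburger
  then show False using assms(3) by (simp add: prod_eq_iff)
qed

text \<open>The parity makes the internal faces at the largest distance \<open>k\<close> active. An
  inactive internal face then lies strictly inside, and each of its edges is shared with an active
  neighbour.\<close>

lemma aztec_darts_active:
  assumes "even (fst c + snd c + int k + r)"
  shows "aztec_darts (Suc k) c = (\<Union>f\<in>active r (Suc k) c. face_darts f)"
proof (intro equalityI subsetI)
  fix e assume "e \<in> aztec_darts (Suc k) c"
  then obtain x y where f: "(x, y) \<in> internal_faces (Suc k) c" and e: "e \<in> face_darts (x, y)"
    by (auto simp: aztec_darts_def)
  show "e \<in> (\<Union>f\<in>active r (Suc k) c. face_darts f)"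
  proof (cases "even (x + y + r)")
    case True
    then show ?thesis using f e by (auto simp: active_def)
  next
    case False
    have "\<bar>x - fst c\<bar> + \<bar>y - snd c\<bar> \<le> int k" using f by (simp add: internal_faces_def)
    moreover have "\<bar>x - fst c\<bar> + \<bar>y - snd c\<bar> \<noteq> int k" using False assms by presburger
    ultimately have lt: "\<bar>x - fst c\<bar> + \<bar>y - snd c\<bar> < int k" by simp
    have nb: "(x, y + 1) \<in> active r (Suc k) c" "(x, y - 1) \<in> active r (Suc k) c"
      "(x + 1, y) \<in> active r (Suc k) c" "(x - 1, y) \<in> active r (Suc k) c"
      using False lt by (auto simp: active_def internal_faces_def)
    have "e \<in> face_darts (x, y + 1) \<or> e \<in> face_darts (x, y - 1) \<or> e \<in> face_darts (x + 1, y) \<or> e \<in> face_darts (x - 1, y)"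
      using e unfolding face_darts_eq insert_iff empty_iff by (elim disjE; simp)
    then show ?thesis using nb by blast
  qed
qed (auto simp: aztec_darts_def active_def)

text \<open>A face at a vertex of the smaller diamond has distance at most \<open>k + 1\<close>, and
  parity excludes equality.\<close>

lemma active_vertex:
  assumes "v \<in> face_corners f" "even (fst f + snd f + r)" "v \<in> aztec_vertices k c"
    and "even (fst c + snd c + int k + r)"
  shows "f \<in> active r (Suc k) c"
proof -
  have "\<bar>fst f - fst c\<bar> + \<bar>snd f - snd c\<bar> \<le> int k + 1 \<and> \<bar>fst f - fst c\<bar> + \<bar>snd f - snd c\<bar> \<noteq> int k + 1"
  proof
    show "\<bar>fst f - fst c\<bar> + \<bar>snd f - snd c\<bar> \<le> int k + 1"
      using assms(3) face_corners_dist(2,4)[OF assms(1)] unfolding mem_aztec_vertices by smt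
    show "\<bar>fst f - fst c\<bar> + \<bar>snd f - snd c\<bar> \<noteq> int k + 1"
      using assms(2,4) by presburger
  qed
  then show ?thesis using assms(2) by (simp add: active_def internal_faces_def)
qed

text \<open>The point reflection of \<open>f\<close> in the vertex \<open>v\<close>, located at
  \<open>(fst v + 1/2, snd v + 1/2)\<close>. At a corner \<open>v\<close> of \<open>f\<close> it
  gives the other face of the same colour.\<close>

definition opposite :: "vertex \<Rightarrow> face \<Rightarrow> face" where
  "opposite v f = (2 * fst v + 1 - fst f, 2 * snd v + 1 - snd f)"

lemma opposite_involutive [simp]: "opposite v (opposite v f) = f"
  by (simp add: opposite_def)

lemma opposite_neq [simp]: "opposite v f \<noteq> f"
proof
  assume "opposite v f = f"
  then have "2 * fst v + 1 = 2 * fst f" by (simp add: opposite_def prod_eq_iff)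
  then show False by presburger
qed

lemma opposite_corner: "v \<in> face_corners (opposite v f) \<longleftrightarrow> v \<in> face_corners f"
  unfolding mem_face_corners opposite_def by auto

lemma opposite_parity: "even (fst (opposite v f) + snd (opposite v f) + r) \<longleftrightarrow> even (fst f + snd f + r)"
  unfolding opposite_def by auto

lemma active_faces_at_vertex:
  assumes "v \<in> face_corners f" "v \<in> face_corners g" "even (fst f + snd f + r)" "even (fst g + snd g + r)"
  shows "g = f \<or> g = opposite v f"
proof -
  have "even ((fst f - fst g) + (snd f - snd g))" using assms(3,4) by auto
  moreover have "fst v = fst f - 1 \<or> fst v = fst f" "snd v = snd f - 1 \<or> snd v = snd f"
     "fst v = fst g - 1 \<or> fst v = fst g" "snd v = snd g - 1 \<or> snd v = snd g"
    using assms(1,2) unfolding mem_face_corners by blast+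
  ultimately show ?thesis
    unfolding opposite_def prod_eq_iff fst_conv snd_conv by presburger
qed

text \<open>\<open>v\<close> is the midpoint of the centres of the two faces of this colour. If both
  had distance at most \<open>k\<close>, so would \<open>v\<close> by the triangle inequality, and
  it would belong to the smaller diamond.\<close>

lemma boundary_vertex_unique:
  assumes "v \<in> aztec_vertices (Suc k) c" "v \<notin> aztec_vertices k c" "even (fst c + snd c + int k + r)"
  shows "\<exists>!f. f \<in> active r (Suc k) c \<and> v \<in> face_corners f"
proof -
  obtain f where f: "f \<in> internal_faces (Suc k) c" "v \<in> face_corners f"
    using assms(1) by (auto simp: aztec_vertices_def)
  have "f \<notin> internal_faces k c" using assms(2) f(2) by (auto simp: aztec_vertices_def)
  then have "\<bar>fst f - fst c\<bar> + \<bar>snd f - snd c\<bar> = int k" using f(1) by (simp add: internal_faces_def)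
  then have "even (fst f + snd f + r)" using assms(3) by presburger
  then have fa: "f \<in> active r (Suc k) c" using f by (simp add: active_def)
  show ?thesis
  proof (rule ex1I[of _ f])
    fix g assume g: "g \<in> active r (Suc k) c \<and> v \<in> face_corners g"
    show "g = f"
    proof (rule ccontr)
      assume "g \<noteq> f"
      then have "g = opposite v f"
        using active_faces_at_vertex[of v f g r] g fa f(2) by (auto simp: active_def)
      then have "fst g + fst f = 2 * fst v + 1" "snd g + snd f = 2 * snd v + 1"
        by (simp_all add: opposite_def)
      moreover have "\<bar>fst f - fst c\<bar> + \<bar>snd f - snd c\<bar> \<le> int k" "\<bar>fst g - fst c\<bar> + \<bar>snd g - snd c\<bar> \<le> int k"
        using fa g by (auto simp: active_def internal_faces_def)
      moreover from calculation(1,2) have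
        "2 * (fst v - fst c) + 1 = (fst f - fst c) + (fst g - fst c)"
        "2 * (snd v - snd c) + 1 = (snd f - snd c) + (snd g - snd c)"
        by (simp_all add: algebra_simps)
      then have "\<bar>2 * (fst v - fst c) + 1\<bar> \<le> \<bar>fst f - fst c\<bar> + \<bar>fst g - fst c\<bar>"
        "\<bar>2 * (snd v - snd c) + 1\<bar> \<le> \<bar>snd f - snd c\<bar> + \<bar>snd g - snd c\<bar>"
        by (simp_all only: abs_triangle_ineq)
      ultimately have "v \<in> aztec_vertices k c" unfolding mem_aztec_vertices by smt
      then show False using assms(2) by simp
    qed
  qed (use fa f in auto)
qed

lemma oriented_dimers_eq_matchings:
  assumes "{e \<in> E. fst e \<in> aztec_vertices k c \<and> snd e \<in> aztec_vertices k c} = aztec_darts k c"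
  shows "oriented_dimers k c = matchings E (aztec_vertices k c)"
  unfolding oriented_dimers_def matchings_def assms ..

lemma aztec_Z_eq_dimer_sum:
  assumes "m = k \<or> m = Suc k"
  shows "aztec_Z m c \<phi> a = dimer_sum (aztec_darts (Suc k) c) (aztec_vertices m c) (dart_weight \<phi> a)"
proof -
  have "oriented_dimers m c = matchings (aztec_darts (Suc k) c) (aztec_vertices m c)"
    by (rule oriented_dimers_eq_matchings)
       (use assms aztec_vertices_mono[of k c] in \<open>auto simp: aztec_darts_induced\<close>)
  then show ?thesis by (simp add: aztec_Z_def dimer_sum_def dart_weight_def)
qed

lemma kasteleyn_iff:
  "kasteleyn k c \<phi> \<longleftrightarrow> (\<forall>f\<in>internal_faces k c. kasteleyn_face \<phi> f)"
  unfolding kasteleyn_def kasteleyn_face_def aztec_darts_def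
  by (simp only: UN_ball_bex_simps ball_conj_distrib ball_simps)

text \<open>A dimer configuration assigns every vertex to one of its active faces; sending each vertex of the
  smaller diamond to its other active face matches the configurations of the two diamonds, and the
  local move relates the contributions of complementary sets of corners.\<close>

theorem aztec_Z_renewal:
  assumes K: "kasteleyn (Suc k) c \<phi>"
    and par: "even (fst c + snd c + int k + r)"
    and upd: "\<And>f. f \<in> active r (Suc k) c \<Longrightarrow> a' f * face_den a f = face_num a f"
    and ne: "\<And>f. f \<in> active r (Suc k) c \<Longrightarrow>
      a (fst f, snd f + 1) \<noteq> a (fst f + 1, snd f) \<and> a (fst f, snd f + 1) \<noteq> a (fst f - 1, snd f) \<and>
      a (fst f, snd f - 1) \<noteq> a (fst f + 1, snd f) \<and> a (fst f, snd f - 1) \<noteq> a (fst f - 1, snd f)"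
    and a': "\<And>g. odd (fst g + snd g + r) \<Longrightarrow> a' g = a g"
  shows "aztec_Z (Suc k) c \<phi> a =
    (\<Prod>f\<in>active r (Suc k) c. face_sign \<phi> f * face_den a f) *
    (\<Prod>v\<in>aztec_vertices k c. vertex_factor r a v) * aztec_Z k c \<phi> a'"
proof -
  define B where "B = active r (Suc k) c"
  define V where "V = aztec_vertices k c"
  define V' where "V' = aztec_vertices (Suc k) c"
  define F where "F v = {f \<in> B. v \<in> face_corners f}" for v
  define L where "L b f S = dimer_sum (face_darts f) S (dart_weight \<phi> b)" for b f S
  define kd where "kd f = face_sign \<phi> f * face_den a f" for f
  \<comment> \<open>\<open>swap\<close> moves every vertex of the smaller diamond to its other
    active face and forgets the boundary vertices. \<open>unswap\<close> restores these, which have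
    no choice but \<open>only v\<close>.\<close>
  define only where "only v = (THE f. f \<in> B \<and> v \<in> face_corners f)" for v
  define swap where "swap \<sigma> = restrict (\<lambda>v. opposite v (\<sigma> v)) V" for \<sigma> :: "vertex \<Rightarrow> face"
  define unswap where "unswap \<tau> = restrict (\<lambda>v. if v \<in> V then opposite v (\<tau> v) else only v) V'" for \<tau> :: "vertex \<Rightarrow> face"
  have fin: "finite B" "finite V" "finite V'"
    by (simp_all add: B_def V_def V'_def finite_active finite_aztec_vertices)
  have VV: "V \<subseteq> V'" unfolding V_def V'_def by (rule aztec_vertices_mono)
  have Bpar: "even (fst f + snd f + r)" if "f \<in> B" for f using that by (simp add: B_def active_def)
  have corB: "face_corners f \<subseteq> V'" if "f \<in> B" for f
    using that by (auto simp: B_def active_def V'_def aztec_vertices_def)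
  have only: "only v \<in> B" "v \<in> face_corners (only v)" "\<And>f. f \<in> B \<Longrightarrow> v \<in> face_corners f \<Longrightarrow> f = only v"
    if "v \<in> V'" "v \<notin> V" for v
  proof -
    have ex: "\<exists>!f. f \<in> B \<and> v \<in> face_corners f"
      unfolding B_def by (rule boundary_vertex_unique[OF _ _ par]) (use that in \<open>auto simp: V_def V'_def\<close>)
    from theI'[OF this] show "only v \<in> B" "v \<in> face_corners (only v)"
      unfolding only_def by auto
    with ex show "\<And>f. f \<in> B \<Longrightarrow> v \<in> face_corners f \<Longrightarrow> f = only v" by blast
  qed
  have oppF: "opposite v f \<in> F v" if "v \<in> V" "f \<in> F v" for v f
  proof -
    have "v \<in> face_corners (opposite v f)" using that by (simp add: F_def opposite_corner)
    moreover have "even (fst (opposite v f) + snd (opposite v f) + r)"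
      unfolding opposite_parity using that Bpar[of f] by (simp add: F_def)
    ultimately have "opposite v f \<in> B"
      unfolding B_def using active_vertex[OF _ _ _ par] that by (simp add: V_def)
    with \<open>v \<in> face_corners (opposite v f)\<close> show ?thesis by (simp add: F_def)
  qed
  have decomp: "aztec_Z m c \<phi> b = (\<Sum>\<sigma>\<in>PiE (aztec_vertices m c) F. \<Prod>f\<in>B. L b f {v \<in> aztec_vertices m c. \<sigma> v = f})"
    if "m = k \<or> m = Suc k" for m b
    unfolding aztec_Z_eq_dimer_sum[OF that] aztec_darts_active[OF par] L_def F_def B_def
  proof (rule dimer_sum_decompose)
    show "face_darts f \<inter> face_darts g = {}" if "f \<in> active r (Suc k) c" "g \<in> active r (Suc k) c" "f \<noteq> g" for f g
      using that by (intro active_face_darts_disjoint[of f r g]) (simp_all add: active_def)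
    show "fst e \<in> face_corners f \<and> snd e \<in> face_corners f" if "e \<in> face_darts f" for e f
      using that by (auto simp: face_darts_def)
  qed (simp_all add: finite_active finite_aztec_vertices finite_face_darts)
  \<comment> \<open>The corners of \<open>f\<close> left free by \<open>\<sigma>\<close> all lie in
    \<open>V\<close>, since a boundary vertex has no other active face. They are assigned to their
    opposite face, so they are exactly the vertices that \<open>swap\<close> sends to
    \<open>f\<close>.\<close>
  have compl: "face_corners f - {v \<in> V'. \<sigma> v = f} = {v \<in> V. swap \<sigma> v = f}"
    if \<sigma>: "\<sigma> \<in> PiE V' F" and f: "f \<in> B" for \<sigma> f
  proof (intro equalityI subsetI)
    fix v assume v: "v \<in> face_corners f - {v \<in> V'. \<sigma> v = f}"
    then have v': "v \<in> V'" "\<sigma> v \<noteq> f" "v \<in> face_corners f" using corB[OF f] by auto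
    have sv: "\<sigma> v \<in> B" "v \<in> face_corners (\<sigma> v)" using \<sigma> v' by (auto simp: F_def)
    have "v \<in> V" using only(3)[OF v'(1)] sv f v' by metis
    moreover have "f = opposite v (\<sigma> v)"
      using active_faces_at_vertex[OF sv(2) v'(3) Bpar[OF sv(1)] Bpar[OF f]] v' by auto
    ultimately show "v \<in> {v \<in> V. swap \<sigma> v = f}" by (simp add: swap_def)
  next
    fix v assume v: "v \<in> {v \<in> V. swap \<sigma> v = f}"
    then have vV: "v \<in> V" "v \<in> V'" and eq: "f = opposite v (\<sigma> v)" using VV by (auto simp: swap_def)
    have "\<sigma> v \<in> F v" using \<sigma> vV by auto
    then show "v \<in> face_corners f - {v \<in> V'. \<sigma> v = f}"
      using oppF[OF vV(1), of "\<sigma> v"] opposite_neq[of v "\<sigma> v"] unfolding eq by (simp add: F_def eq_commute)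
  qed
  have step: "(\<Prod>f\<in>B. L a f {v \<in> V'. \<sigma> v = f}) =
      (\<Prod>f\<in>B. kd f) * (\<Prod>v\<in>V. vertex_factor r a v) * (\<Prod>f\<in>B. L a' f {v \<in> V. swap \<sigma> v = f})"
    if \<sigma>: "\<sigma> \<in> PiE V' F" for \<sigma>
  proof -
    have "L a f {v \<in> V'. \<sigma> v = f} = kd f * (\<Prod>v\<in>{v \<in> V. swap \<sigma> v = f}. vertex_factor r a v) *
        L a' f {v \<in> V. swap \<sigma> v = f}" if f: "f \<in> B" for f
    proof -
      have "kasteleyn_face \<phi> f" using K f by (simp add: kasteleyn_iff B_def active_def)
      moreover have "{v \<in> V'. \<sigma> v = f} \<subseteq> face_corners f" using \<sigma> by (auto simp: F_def)
      ultimately show ?thesis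
        unfolding L_def kd_def compl[OF \<sigma> f, symmetric]
        using local_move[of \<phi> f r a' a "{v \<in> V'. \<sigma> v = f}"] upd[of f] ne[of f] a' f Bpar[OF f]
        unfolding B_def by blast
    qed
    \<comment> \<open>The fibres of \<open>swap \<sigma>\<close> partition \<open>V\<close>, so
      every gauge factor is collected once, whatever \<open>\<sigma>\<close> is.\<close>
    moreover have "(\<Prod>f\<in>B. \<Prod>v\<in>{v \<in> V. swap \<sigma> v = f}. vertex_factor r a v) = (\<Prod>v\<in>V. vertex_factor r a v)"
    proof (rule prod.group)
      show "swap \<sigma> ` V \<subseteq> B" using \<sigma> oppF VV by (fastforce simp: swap_def F_def)
    qed (use fin in auto)
    ultimately show ?thesis by (simp add: prod.distrib)
  qed
  have "(\<Sum>\<sigma>\<in>PiE V' F. \<Prod>f\<in>B. L a' f {v \<in> V. swap \<sigma> v = f}) = (\<Sum>\<tau>\<in>PiE V F. \<Prod>f\<in>B. L a' f {v \<in> V. \<tau> v = f})"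
  proof (rule sum.reindex_bij_witness[where j = swap and i = unswap])
    fix \<sigma> assume \<sigma>: "\<sigma> \<in> PiE V' F"
    show "swap \<sigma> \<in> PiE V F"
      unfolding swap_def restrict_PiE_iff using \<sigma> VV by (intro ballI oppF) auto
    show "unswap (swap \<sigma>) = \<sigma>"
    proof
      fix v
      consider "v \<notin> V'" | "v \<in> V" "v \<in> V'" | "v \<in> V'" "v \<notin> V" using VV by blast
      then show "unswap (swap \<sigma>) v = \<sigma> v"
      proof cases
        case 1
        then show ?thesis using PiE_arb[OF \<sigma>] by (simp add: unswap_def)
      next
        case 2
        then show ?thesis by (simp add: unswap_def swap_def)
      next
        case 3
        then have "\<sigma> v \<in> F v" using \<sigma> by auto
        then show ?thesis using 3 only(3)[of v "\<sigma> v"] by (auto simp: unswap_def F_def)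
      qed
    qed
  next
    fix \<tau> assume \<tau>: "\<tau> \<in> PiE V F"
    show "unswap \<tau> \<in> PiE V' F"
      unfolding unswap_def restrict_PiE_iff
    proof
      fix v assume v: "v \<in> V'"
      show "(if v \<in> V then opposite v (\<tau> v) else only v) \<in> F v"
      proof (cases "v \<in> V")
        case True
        then show ?thesis using \<tau> oppF[of v "\<tau> v"] by auto
      next
        case False
        then show ?thesis using only(1,2)[OF v] by (simp add: F_def)
      qed
    qed
    show "swap (unswap \<tau>) = \<tau>"
    proof
      fix v show "swap (unswap \<tau>) v = \<tau> v"
        using PiE_arb[OF \<tau>, of v] VV by (auto simp: swap_def unswap_def)
    qed
  qed auto
  then show ?thesis
    using decomp[of "Suc k" a] decomp[of k a'] step
    by (simp add: sum_distrib_left[symmetric] V_def V'_def B_def kd_def)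
qed

section \<open>The ratio function\<close>

lemma mem_aztec_faces: "g \<in> aztec_faces k c \<longleftrightarrow> \<bar>fst g - fst c\<bar> + \<bar>snd g - snd c\<bar> \<le> int k"
  by (auto simp: aztec_faces_def internal_faces_def open_faces_def)

definition neighbours :: "face \<Rightarrow> face set" where
  "neighbours f = {(fst f, snd f + 1), (fst f + 1, snd f), (fst f, snd f - 1), (fst f - 1, snd f)}"

definition inactive :: "int \<Rightarrow> nat \<Rightarrow> face \<Rightarrow> face set" where
  "inactive r k c = {g \<in> aztec_faces k c. odd (fst g + snd g + r)}"

text \<open>The weights of the two inactive faces at \<open>v\<close>. Up to sign,
  \<open>vertex_factor\<close> acquires this factor under inversion of the weights, since 1 / (1/P -
  1/Q) = - P Q / (P - Q).\<close>

definition inactive_product :: "int \<Rightarrow> (face \<Rightarrow> complex) \<Rightarrow> vertex \<Rightarrow> complex" where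
  "inactive_product r a v =
     (if even (fst v + snd v + r) then a (fst v, snd v + 1) * a (fst v + 1, snd v)
      else a v * a (fst v + 1, snd v + 1))"

lemma finite_inactive: "finite (inactive r k c)"
  by (simp add: inactive_def finite_aztec_faces)

text \<open>Faces at distance \<open>k\<close> have the active colour, faces at distance
  \<open>k + 1\<close> the other one. So both diamonds contain the same active faces, and shrinking
  loses only inactive ones.\<close>

lemma aztec_faces_split:
  assumes "even (fst c + snd c + int k + r)" "m = k \<or> m = Suc k"
  shows "aztec_faces m c = active r (Suc k) c \<union> inactive r m c"
    "active r (Suc k) c \<inter> inactive r m c = {}"
proof -
  have "g \<in> active r (Suc k) c \<longleftrightarrow> g \<in> aztec_faces m c \<and> even (fst g + snd g + r)" for g
  proof -
    have "\<bar>fst g - fst c\<bar> + \<bar>snd g - snd c\<bar> \<noteq> int (Suc k)" if "even (fst g + snd g + r)"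
      using that assms(1) by presburger
    then have "even (fst g + snd g + r) \<Longrightarrow>
        (\<bar>fst g - fst c\<bar> + \<bar>snd g - snd c\<bar> < int (Suc k)) = (\<bar>fst g - fst c\<bar> + \<bar>snd g - snd c\<bar> \<le> int m)"
      using assms(2) by (elim disjE; simp only: of_nat_Suc; linarith)
    then show ?thesis
      unfolding active_def internal_faces_def mem_aztec_faces mem_Collect_eq by blast
  qed
  then show "aztec_faces m c = active r (Suc k) c \<union> inactive r m c"
    "active r (Suc k) c \<inter> inactive r m c = {}"
    by (auto simp: inactive_def)
qed

lemma neighbours_active:
  assumes "f \<in> active r (Suc k) c"
  shows "neighbours f \<subseteq> inactive r (Suc k) c"
  using assms by (auto simp: neighbours_def inactive_def mem_aztec_faces active_def internal_faces_def)

lemma card_filter_4: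
  assumes "distinct [a, b, c, d]"
  shows "card {x \<in> S. x \<in> {a, b, c, d}} =
    of_bool (a \<in> S) + of_bool (b \<in> S) + of_bool (c \<in> S) + of_bool (d \<in> S)"
proof -
  have "{x \<in> S. x \<in> {a, b, c, d}} = {x \<in> {a, b, c, d}. x \<in> S}" by blast
  then have "card {x \<in> S. x \<in> {a, b, c, d}} = (\<Sum>x\<in>{a, b, c, d}. of_bool (x \<in> S))"
    by (simp add: sum.If_cases of_bool_def Int_def)
  then show ?thesis using assms by simp
qed

text \<open>The two sides are the exponents of the weight of \<open>g\<close> in
  \<open>face_weight_count\<close>. In the interior both are \<open>1 + 4\<close>. At distance
  \<open>k + 1\<close> they are \<open>1 + 1\<close> and \<open>0 + 2\<close> off the axes through
  the centre, and \<open>1 + 0\<close> and \<open>0 + 1\<close> on them.\<close>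

lemma incidence_count:
  assumes par: "even (fst c + snd c + int k + r)" and g: "g \<in> inactive r (Suc k) c"
  shows "1 + card {v \<in> aztec_vertices k c. v \<in> face_corners g} =
    of_bool (g \<in> aztec_faces k c) + card {f \<in> active r (Suc k) c. g \<in> neighbours f}"
proof -
  obtain x y where xy: "g = (x, y)" by (cases g)
  define X Y K where "X = x - fst c" and "Y = y - snd c" and "K = int k"
  have odd: "odd (x + y + r)" using g by (simp add: inactive_def xy)
  have le: "\<bar>X\<bar> + \<bar>Y\<bar> \<le> K + 1" using g by (simp add: inactive_def xy mem_aztec_faces X_def Y_def K_def)
  have "\<bar>X\<bar> + \<bar>Y\<bar> \<noteq> K" unfolding X_def Y_def K_def using odd par by presburger
  then have dist: "\<bar>X\<bar> + \<bar>Y\<bar> = K + 1 \<or> \<bar>X\<bar> + \<bar>Y\<bar> < K" using le by linarith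
  have nb: "(g \<in> neighbours f) = (f \<in> {(x, y - 1), (x - 1, y), (x, y + 1), (x + 1, y)})" for f
    by (cases f) (auto simp: neighbours_def xy)
  have B: "((x + i, y + j) \<in> active r (Suc k) c) = (\<bar>X + i\<bar> + \<bar>Y + j\<bar> \<le> K)" if "odd (i + j)" for i j
  proof -
    have "even (x + i + (y + j) + r)" using odd that by presburger
    then show ?thesis by (auto simp: active_def internal_faces_def X_def Y_def K_def algebra_simps)
  qed
  have C: "((x + i, y + j) \<in> aztec_vertices k c) = (\<bar>2 * (X + i) + 1\<bar> + \<bar>2 * (Y + j) + 1\<bar> \<le> 2 * K)" for i j
    unfolding mem_aztec_vertices X_def Y_def K_def fst_conv snd_conv by (simp add: algebra_simps)
  have cards: "card {v \<in> aztec_vertices k c. v \<in> face_corners g} =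
      of_bool (\<bar>2 * X - 1\<bar> + \<bar>2 * Y + 1\<bar> \<le> 2 * K) + of_bool (\<bar>2 * X + 1\<bar> + \<bar>2 * Y + 1\<bar> \<le> 2 * K) +
      of_bool (\<bar>2 * X + 1\<bar> + \<bar>2 * Y - 1\<bar> \<le> 2 * K) + of_bool (\<bar>2 * X - 1\<bar> + \<bar>2 * Y - 1\<bar> \<le> 2 * K)"
    unfolding xy face_corners_eq
    using C[of "-1" 0] C[of 0 0] C[of 0 "-1"] C[of "-1" "-1"]
    by (subst card_filter_4) (simp_all add: algebra_simps)
  have cards': "card {f \<in> active r (Suc k) c. g \<in> neighbours f} =
      of_bool (\<bar>X\<bar> + \<bar>Y - 1\<bar> \<le> K) + of_bool (\<bar>X - 1\<bar> + \<bar>Y\<bar> \<le> K) +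
      of_bool (\<bar>X\<bar> + \<bar>Y + 1\<bar> \<le> K) + of_bool (\<bar>X + 1\<bar> + \<bar>Y\<bar> \<le> K)"
    unfolding nb
    using B[of "-1" 0] B[of 1 0] B[of 0 "-1"] B[of 0 1]
    by (subst card_filter_4) simp_all
  have inA: "(g \<in> aztec_faces k c) = (\<bar>X\<bar> + \<bar>Y\<bar> \<le> K)"
    by (simp add: xy mem_aztec_faces X_def Y_def K_def)
  \<comment> \<open>Reflections in the axes permute the four corners and the four neighbours of
    \<open>g\<close>, so only the absolute values of the offsets matter.\<close>
  have sym: "(\<bar>2 * t - 1\<bar> = \<bar>2 * \<bar>t\<bar> - 1\<bar> \<and> \<bar>2 * t + 1\<bar> = 2 * \<bar>t\<bar> + 1 \<and> \<bar>t - 1\<bar> = \<bar>\<bar>t\<bar> - 1\<bar> \<and> \<bar>t + 1\<bar> = \<bar>t\<bar> + 1) \<or>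
      (\<bar>2 * t + 1\<bar> = \<bar>2 * \<bar>t\<bar> - 1\<bar> \<and> \<bar>2 * t - 1\<bar> = 2 * \<bar>t\<bar> + 1 \<and> \<bar>t + 1\<bar> = \<bar>\<bar>t\<bar> - 1\<bar> \<and> \<bar>t - 1\<bar> = \<bar>t\<bar> + 1)" for t :: int
    by smt
  have main: "1 + (of_bool (\<bar>2 * a - 1\<bar> + (2 * b + 1) \<le> 2 * K) + of_bool ((2 * a + 1) + (2 * b + 1) \<le> 2 * K) +
      of_bool ((2 * a + 1) + \<bar>2 * b - 1\<bar> \<le> 2 * K) + of_bool (\<bar>2 * a - 1\<bar> + \<bar>2 * b - 1\<bar> \<le> 2 * K)) =
      of_bool (a + b \<le> K) + (of_bool (a + \<bar>b - 1\<bar> \<le> K) + of_bool (\<bar>a - 1\<bar> + b \<le> K) +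
      of_bool (a + (b + 1) \<le> K) + (of_bool ((a + 1) + b \<le> K) :: nat))"
    if "a \<ge> 0" "b \<ge> 0" "a + b = K + 1 \<or> a + b < K" for a b
    using that(3)
  proof
    assume K: "a + b = K + 1"
    have iffs: "(\<bar>2 * a - 1\<bar> + (2 * b + 1) \<le> 2 * K) = False" "((2 * a + 1) + (2 * b + 1) \<le> 2 * K) = False"
      "((2 * a + 1) + \<bar>2 * b - 1\<bar> \<le> 2 * K) = False" "(\<bar>2 * a - 1\<bar> + \<bar>2 * b - 1\<bar> \<le> 2 * K) = (a \<ge> 1 \<and> b \<ge> 1)"
      "(a + b \<le> K) = False" "(a + \<bar>b - 1\<bar> \<le> K) = (b \<ge> 1)" "(\<bar>a - 1\<bar> + b \<le> K) = (a \<ge> 1)"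
      "(a + (b + 1) \<le> K) = False" "((a + 1) + b \<le> K) = False"
      using that(1,2) K by smt+
    have "a \<ge> 1 \<or> b \<ge> 1" using that(1,2) K by (simp add: K_def) linarith
    then show ?thesis unfolding iffs by (auto simp: of_bool_def)
  next
    assume K: "a + b < K"
    have iffs: "(\<bar>2 * a - 1\<bar> + (2 * b + 1) \<le> 2 * K) = True" "((2 * a + 1) + (2 * b + 1) \<le> 2 * K) = True"
      "((2 * a + 1) + \<bar>2 * b - 1\<bar> \<le> 2 * K) = True" "(\<bar>2 * a - 1\<bar> + \<bar>2 * b - 1\<bar> \<le> 2 * K) = True"
      "(a + b \<le> K) = True" "(a + \<bar>b - 1\<bar> \<le> K) = True" "(\<bar>a - 1\<bar> + b \<le> K) = True"
      "(a + (b + 1) \<le> K) = True" "((a + 1) + b \<le> K) = True"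
      using that(1,2) K by smt+
    show ?thesis unfolding iffs by simp
  qed
  show ?thesis
    using sym[of X] sym[of Y] main[OF abs_ge_zero abs_ge_zero dist]
    unfolding cards cards' inA by (elim disjE conjE; simp only: add_ac)
qed

lemma face_weight_count:
  assumes par: "even (fst c + snd c + int k + r)"
  shows "(\<Prod>g\<in>inactive r (Suc k) c. a g) * (\<Prod>v\<in>aztec_vertices k c. inactive_product r a v) =
    (\<Prod>g\<in>inactive r k c. a g) * (\<Prod>f\<in>active r (Suc k) c. \<Prod>g\<in>neighbours f. a g)"
proof -
  let ?I = "inactive r (Suc k) c" and ?V = "aztec_vertices k c" and ?B = "active r (Suc k) c"
  have V: "inactive_product r a v = (\<Prod>g\<in>{g \<in> ?I. v \<in> face_corners g}. a g)" if v: "v \<in> ?V" for v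
  proof -
    define p q where "p = fst v" and "q = snd v"
    have 0: "g \<in> aztec_faces (Suc k) c" if "v \<in> face_corners g" for g
      using face_corners_dist(2)[OF that, of "fst c"] face_corners_dist(4)[OF that, of "snd c"]
        v unfolding mem_aztec_vertices mem_aztec_faces of_nat_Suc by smt
    have vpq: "v = (p, q)" by (simp add: p_def q_def)
    have 1: "v \<in> face_corners g \<longleftrightarrow> g \<in> {(p, q), (p + 1, q), (p, q + 1), (p + 1, q + 1)}" for g
      by (cases g) (auto simp: mem_face_corners p_def q_def)
    have 2: "{g \<in> ?I. v \<in> face_corners g} =
        {g \<in> {(p, q), (p + 1, q), (p, q + 1), (p + 1, q + 1)}. odd (fst g + snd g + r)}"
      using 0 1 by (auto simp: inactive_def)
    show ?thesis
    proof (cases "even (p + q + r)")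
      case True
      then have "{g \<in> ?I. v \<in> face_corners g} = {(p, q + 1), (p + 1, q)}" unfolding 2 by auto
      then show ?thesis using True by (simp add: inactive_product_def vpq)
    next
      case False
      then have "{g \<in> ?I. v \<in> face_corners g} = {(p, q), (p + 1, q + 1)}" unfolding 2 by auto
      then show ?thesis using False by (simp add: inactive_product_def vpq)
    qed
  qed
  have "(\<Prod>g\<in>?I. a g) * (\<Prod>v\<in>?V. inactive_product r a v) =
      (\<Prod>g\<in>?I. a g) * (\<Prod>v\<in>?V. \<Prod>g\<in>{g \<in> ?I. v \<in> face_corners g}. a g)"
    by (simp add: V)
  also have "(\<Prod>v\<in>?V. \<Prod>g\<in>{g \<in> ?I. v \<in> face_corners g}. a g) =
      (\<Prod>g\<in>?I. \<Prod>v\<in>{v \<in> ?V. v \<in> face_corners g}. a g)"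
    by (rule prod.swap_restrict) (simp_all add: finite_inactive finite_aztec_vertices)
  also have "(\<Prod>g\<in>?I. a g) * \<dots> = (\<Prod>g\<in>?I. a g ^ (1 + card {v \<in> ?V. v \<in> face_corners g}))"
    by (simp add: prod.distrib)
  also have "\<dots> = (\<Prod>g\<in>?I. a g ^ (of_bool (g \<in> aztec_faces k c) + card {f \<in> ?B. g \<in> neighbours f}))"
    by (intro prod.cong refl) (simp only: incidence_count[OF par])
  also have "\<dots> = (\<Prod>g\<in>?I. if g \<in> aztec_faces k c then a g else 1) * (\<Prod>g\<in>?I. \<Prod>f\<in>{f \<in> ?B. g \<in> neighbours f}. a g)"
    unfolding prod.distrib[symmetric] by (intro prod.cong refl) (simp add: power_add)
  also have "(\<Prod>g\<in>?I. \<Prod>f\<in>{f \<in> ?B. g \<in> neighbours f}. a g) = (\<Prod>f\<in>?B. \<Prod>g\<in>{g \<in> ?I. g \<in> neighbours f}. a g)"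
    by (rule prod.swap_restrict) (simp_all add: finite_inactive finite_active)
  also have "\<dots> = (\<Prod>f\<in>?B. \<Prod>g\<in>neighbours f. a g)"
    by (intro prod.cong refl) (use neighbours_active in blast)
  also have "(\<Prod>g\<in>?I. if g \<in> aztec_faces k c then a g else 1) = (\<Prod>g\<in>{g \<in> ?I. g \<in> aztec_faces k c}. a g)"
    by (simp add: prod.inter_filter finite_inactive)
  also have "{g \<in> ?I. g \<in> aztec_faces k c} = inactive r k c"
    by (auto simp: inactive_def mem_aztec_faces)
  finally show ?thesis .
qed

text \<open>The reflection in the vertical line through the centre exchanges the colours. Evenness
  cancels the signs that the gauge factors acquire under inversion of the weights.\<close>

lemma even_card_aztec_vertices: "even (card (aztec_vertices k c))"
proof -
  define refl where "refl v = (2 * fst c - 1 - fst v, snd v)" for v :: vertex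
  let ?W = "{v \<in> aztec_vertices k c. white v}" and ?B = "{v \<in> aztec_vertices k c. \<not> white v}"
  have "bij_betw refl ?W ?B"
  proof (rule bij_betw_byWitness[where f' = refl])
    have "refl v \<in> aztec_vertices k c" if "v \<in> aztec_vertices k c" for v
      using that unfolding mem_aztec_vertices refl_def fst_conv snd_conv by smt
    moreover have "white (refl v) \<longleftrightarrow> \<not> white v" for v unfolding white_def refl_def by auto
    ultimately show "refl ` ?W \<subseteq> ?B" "refl ` ?B \<subseteq> ?W" by auto
  qed (auto simp: refl_def)
  then have "card ?W = card ?B" by (rule bij_betw_same_card)
  moreover have "card (aztec_vertices k c) = card (?W \<union> ?B)" by (rule arg_cong[where f = card]) auto
  moreover have "\<dots> = card ?W + card ?B"
    by (rule card_Un_disjoint) (auto simp: finite_aztec_vertices)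
  ultimately show ?thesis by simp
qed

text \<open>Inversion exchanges numerator and denominator up to a common monomial, which is why the
  inverse weights solve the same recurrence.\<close>

lemma face_den_num_inverse:
  assumes "a f \<noteq> 0" "\<And>g. g \<in> neighbours f \<Longrightarrow> a g \<noteq> 0"
  shows "face_den (\<lambda>g. inverse (a g)) f = face_num a f / (a f * (\<Prod>g\<in>neighbours f. a g))"
    "face_num (\<lambda>g. inverse (a g)) f = face_den a f / (a f * (\<Prod>g\<in>neighbours f. a g))"
proof -
  obtain x n e s w where xx: "x = a f" "n = a (fst f, snd f + 1)" "e = a (fst f + 1, snd f)"
    "s = a (fst f, snd f - 1)" "w = a (fst f - 1, snd f)" by simp
  have nz: "x \<noteq> 0" "n \<noteq> 0" "e \<noteq> 0" "s \<noteq> 0" "w \<noteq> 0"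
    using assms by (auto simp: xx neighbours_def)
  have P: "(\<Prod>g\<in>neighbours f. a g) = n * e * s * w"
    by (simp add: neighbours_def xx)
  show "face_den (\<lambda>g. inverse (a g)) f = face_num a f / (a f * (\<Prod>g\<in>neighbours f. a g))"
    "face_num (\<lambda>g. inverse (a g)) f = face_den a f / (a f * (\<Prod>g\<in>neighbours f. a g))"
    unfolding P unfolding face_den_def face_num_def xx[symmetric] upd_den_def upd_num_def
    using nz by (simp_all add: field_simps)
qed

text \<open>\<open>aztec_Z_renewal\<close> applies to \<open>a\<close> and to its inverse. The
  quotient of the two prefactors is a monomial: \<open>face_den_num_inverse\<close> contributes the
  active faces and their neighbours, \<open>inactive_product\<close> the vertices. By
  \<open>face_weight_count\<close> it turns the product over the larger set of faces into that over
  the smaller one.\<close>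

theorem aztec_Y_renewal:
  assumes K: "kasteleyn (Suc k) c \<phi>"
    and par: "even (fst c + snd c + int k + r)"
    and nz: "\<And>g. g \<in> aztec_faces (Suc k) c \<Longrightarrow> a g \<noteq> 0"
    and den: "\<And>f. f \<in> active r (Suc k) c \<Longrightarrow> face_den a f \<noteq> 0"
    and upd: "\<And>f. f \<in> active r (Suc k) c \<Longrightarrow> a' f * face_den a f = face_num a f"
    and nz': "\<And>f. f \<in> active r (Suc k) c \<Longrightarrow> a' f \<noteq> 0"
    and ne: "\<And>f. f \<in> active r (Suc k) c \<Longrightarrow>
      a (fst f, snd f + 1) \<noteq> a (fst f + 1, snd f) \<and> a (fst f, snd f + 1) \<noteq> a (fst f - 1, snd f) \<and>
      a (fst f, snd f - 1) \<noteq> a (fst f + 1, snd f) \<and> a (fst f, snd f - 1) \<noteq> a (fst f - 1, snd f)"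
    and a': "\<And>g. odd (fst g + snd g + r) \<Longrightarrow> a' g = a g"
    and Z: "aztec_Z k c \<phi> a' \<noteq> 0"
  shows "aztec_Z (Suc k) c \<phi> a \<noteq> 0" "aztec_Y_complex (Suc k) c \<phi> a = aztec_Y_complex k c \<phi> a'"
proof -
  let ?B = "active r (Suc k) c" and ?V = "aztec_vertices k c"
  define b b' where "b g = inverse (a g)" and "b' g = inverse (a' g)" for g
  define N where "N f = (\<Prod>g\<in>neighbours f. a g)" for f
  have nzB: "a f \<noteq> 0" "\<And>g. g \<in> neighbours f \<Longrightarrow> a g \<noteq> 0" if "f \<in> ?B" for f
    using nz aztec_faces_split(1)[OF par, of "Suc k"] neighbours_active[OF that] that by auto
  have nN: "N f \<noteq> 0" if "f \<in> ?B" for f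
    unfolding N_def using nzB(2)[OF that] by (simp add: neighbours_def)
  have denb: "face_den b f = a' f * face_den a f / (a f * N f)" if "f \<in> ?B" for f
    unfolding b_def N_def using face_den_num_inverse(1)[of a f, OF nzB[OF that]] upd[OF that] by simp
  have numb: "face_num b f = face_den a f / (a f * N f)" if "f \<in> ?B" for f
    unfolding b_def N_def using face_den_num_inverse(2)[of a f, OF nzB[OF that]] by simp
  have Za: "aztec_Z (Suc k) c \<phi> a =
    (\<Prod>f\<in>?B. face_sign \<phi> f * face_den a f) * (\<Prod>v\<in>?V. vertex_factor r a v) * aztec_Z k c \<phi> a'"
    by (rule aztec_Z_renewal[OF K par upd ne a'])
  have Zb: "aztec_Z (Suc k) c \<phi> b =
    (\<Prod>f\<in>?B. face_sign \<phi> f * face_den b f) * (\<Prod>v\<in>?V. vertex_factor r b v) * aztec_Z k c \<phi> b'"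
  proof (rule aztec_Z_renewal[OF K par])
    show "b' f * face_den b f = face_num b f" if "f \<in> ?B" for f
      using nz'[OF that] by (simp add: denb[OF that] numb[OF that] b'_def)
  qed (use ne a' in \<open>auto simp: b_def b'_def\<close>)
  have sign: "face_sign \<phi> f \<noteq> 0" if "f \<in> ?B" for f
  proof -
    have "kasteleyn_face \<phi> (fst f, snd f)" using K that by (simp add: kasteleyn_iff active_def)
    from kasteleyn_face_product[OF this] show ?thesis by (auto simp: face_sign_def)
  qed
  have vf: "vertex_factor r a v \<noteq> 0" "vertex_factor r b v = - inactive_product r a v * vertex_factor r a v"
    if v: "v \<in> ?V" for v
  proof -
    define p q where "p = fst v" and "q = snd v"
    have vpq: "v = (p, q)" by (simp add: p_def q_def)
    have inv: "\<epsilon> / (inverse P - inverse Q) = - (P * Q) * (\<epsilon> / (P - Q))" if "P \<noteq> 0" "Q \<noteq> 0" "P \<noteq> Q" for \<epsilon> P Q :: complex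
      using that by (simp add: field_simps)
    have "vertex_factor r a v \<noteq> 0 \<and> vertex_factor r b v = - inactive_product r a v * vertex_factor r a v"
    proof (cases "even (p + q + r)")
      case True
      then have f: "(p, q) \<in> ?B" using v
        by (intro active_vertex[OF _ _ v par]) (auto simp: mem_face_corners vpq)
      have "a (p, q + 1) \<noteq> 0" "a (p + 1, q) \<noteq> 0" using nzB(2)[OF f] by (auto simp: neighbours_def)
      moreover have "a (p, q + 1) \<noteq> a (p + 1, q)" using ne[OF f] by simp
      ultimately show ?thesis
        using inv[of "a (p, q + 1)" "a (p + 1, q)"] True
        by (simp add: vertex_factor_def inactive_product_def vpq b_def)
    next
      case False
      then have f: "(p, q + 1) \<in> ?B" using v
        by (intro active_vertex[OF _ _ v par]) (auto simp: mem_face_corners vpq)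
      have "a (p, q) \<noteq> 0" "a (p + 1, q + 1) \<noteq> 0" using nzB(2)[OF f] by (auto simp: neighbours_def)
      moreover have "a (p, q) \<noteq> a (p + 1, q + 1)" using ne[OF f] by simp
      ultimately show ?thesis
        using inv[of "a (p, q)" "a (p + 1, q + 1)"] False
        by (simp add: vertex_factor_def inactive_product_def vpq b_def)
    qed
    then show "vertex_factor r a v \<noteq> 0" "vertex_factor r b v = - inactive_product r a v * vertex_factor r a v"
      by auto
  qed
  define C where "C = (\<Prod>f\<in>?B. face_sign \<phi> f * face_den a f) * (\<Prod>v\<in>?V. vertex_factor r a v)"
  have C: "C \<noteq> 0"
    using sign den vf(1) by (simp add: C_def finite_active finite_aztec_vertices)
  show "aztec_Z (Suc k) c \<phi> a \<noteq> 0" using C Z by (simp add: Za C_def)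
  have "(\<Prod>v\<in>?V. vertex_factor r b v) = (\<Prod>v\<in>?V. - inactive_product r a v) * (\<Prod>v\<in>?V. vertex_factor r a v)"
    using vf(2) by (simp add: prod.distrib[symmetric])
  also have "(\<Prod>v\<in>?V. - inactive_product r a v) = (\<Prod>v\<in>?V. inactive_product r a v)"
    using even_card_aztec_vertices[of k c] by (simp add: prod_uminus)
  finally have vfb: "(\<Prod>v\<in>?V. vertex_factor r b v) =
      (\<Prod>v\<in>?V. inactive_product r a v) * (\<Prod>v\<in>?V. vertex_factor r a v)" .
  have dfb: "(\<Prod>f\<in>?B. face_sign \<phi> f * face_den b f) =
      (\<Prod>f\<in>?B. a' f) / ((\<Prod>f\<in>?B. a f) * (\<Prod>f\<in>?B. N f)) * (\<Prod>f\<in>?B. face_sign \<phi> f * face_den a f)"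
    unfolding prod_dividef[symmetric] prod.distrib[symmetric] by (intro prod.cong refl) (simp add: denb)
  have Zb': "aztec_Z (Suc k) c \<phi> b =
      C * ((\<Prod>v\<in>?V. inactive_product r a v) * (\<Prod>f\<in>?B. a' f) / ((\<Prod>f\<in>?B. a f) * (\<Prod>f\<in>?B. N f))) * aztec_Z k c \<phi> b'"
    unfolding Zb vfb dfb C_def by simp
  have pa: "(\<Prod>g\<in>aztec_faces (Suc k) c. a g) = (\<Prod>f\<in>?B. a f) * (\<Prod>g\<in>inactive r (Suc k) c. a g)"
    unfolding aztec_faces_split(1)[OF par disjI2[OF refl]]
    by (rule prod.union_disjoint) (simp_all add: finite_active finite_inactive aztec_faces_split(2)[OF par])
  have pa': "(\<Prod>g\<in>aztec_faces k c. a' g) = (\<Prod>f\<in>?B. a' f) * (\<Prod>g\<in>inactive r k c. a g)"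
  proof -
    have "(\<Prod>g\<in>aztec_faces k c. a' g) = (\<Prod>f\<in>?B. a' f) * (\<Prod>g\<in>inactive r k c. a' g)"
      unfolding aztec_faces_split(1)[OF par disjI1[OF refl]]
      by (rule prod.union_disjoint) (simp_all add: finite_active finite_inactive aztec_faces_split(2)[OF par])
    also have "(\<Prod>g\<in>inactive r k c. a' g) = (\<Prod>g\<in>inactive r k c. a g)"
      by (intro prod.cong refl a') (simp add: inactive_def)
    finally show ?thesis .
  qed
  have nzp: "(\<Prod>f\<in>?B. a f) \<noteq> 0" "(\<Prod>f\<in>?B. N f) \<noteq> 0"
    using nzB(1) nN by (simp_all add: finite_active)
  have "aztec_Y_complex (Suc k) c \<phi> a =
      (\<Prod>g\<in>aztec_faces (Suc k) c. a g) * (aztec_Z (Suc k) c \<phi> b / aztec_Z (Suc k) c \<phi> a)"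
    by (simp add: aztec_Y_complex_def b_def[abs_def])
  also have "\<dots> = ((\<Prod>g\<in>inactive r (Suc k) c. a g) * (\<Prod>v\<in>?V. inactive_product r a v)) *
      (\<Prod>f\<in>?B. a' f) / (\<Prod>f\<in>?B. N f) * (aztec_Z k c \<phi> b' / aztec_Z k c \<phi> a')"
    unfolding pa Zb' Za C_def[symmetric] using C nzp(1) by (simp add: field_simps)
  also have "\<dots> = (\<Prod>g\<in>aztec_faces k c. a' g) * (aztec_Z k c \<phi> b' / aztec_Z k c \<phi> a')"
    unfolding face_weight_count[OF par] N_def[symmetric] pa' using nzp(2) by simp
  also have "\<dots> = aztec_Y_complex k c \<phi> a'"
    by (simp add: aztec_Y_complex_def b'_def[abs_def])
  finally show "aztec_Y_complex (Suc k) c \<phi> a = aztec_Y_complex k c \<phi> a'" .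
qed

section \<open>The dSKP recurrence in homogeneous coordinates\<close>

definition wedge :: "'a::comm_ring_1 \<times> 'a \<Rightarrow> 'a \<times> 'a \<Rightarrow> 'a" where
  "wedge x y = fst x * snd y - fst y * snd x"

text \<open>The dSKP update in homogeneous coordinates, which makes sense at infinity and over a ring of
  polynomials.\<close>

definition hom_upd :: "'a::comm_ring_1 \<times> 'a \<Rightarrow> 'a \<times> 'a \<Rightarrow> 'a \<times> 'a \<Rightarrow> 'a \<times> 'a \<Rightarrow> 'a \<times> 'a \<Rightarrow> 'a \<times> 'a" where
  "hom_upd x n e s w =
     (wedge n w * wedge e x * fst s - wedge x n * wedge s e * fst w,
      wedge n w * wedge e x * snd s - wedge x n * wedge s e * snd w)"

text \<open>Common factors are never cancelled, so polynomial entries stay polynomial; by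
  \<open>hom_upd_scale\<close> the choice of representatives is harmless. Step \<open>m\<close>
  updates the colour that is active for \<open>r = int m\<close>.\<close>

primrec hom_state :: "(face \<Rightarrow> 'a::comm_ring_1 \<times> 'a) \<Rightarrow> nat \<Rightarrow> face \<Rightarrow> 'a \<times> 'a" where
  "hom_state h 0 = h"
| "hom_state h (Suc m) = (\<lambda>f.
     if even (fst f + snd f + int m)
     then hom_upd (hom_state h m f) (hom_state h m (fst f, snd f + 1)) (hom_state h m (fst f + 1, snd f))
       (hom_state h m (fst f, snd f - 1)) (hom_state h m (fst f - 1, snd f))
     else hom_state h m f)"

lemma hom_upd_affine:
  "hom_upd (x * a, a) (n * b, b) (e * c, c) (s * d, d) (w * g, g) =
     (upd_num x n e s w * (a * b * c * d * g), upd_den x n e s w * (a * b * c * d * g))"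
  by (simp add: hom_upd_def wedge_def upd_num_def upd_den_def algebra_simps)

lemma hom_upd_scale:
  "hom_upd (a * fst x, a * snd x) (b * fst n, b * snd n) (c * fst e, c * snd e) (d * fst s, d * snd s) (g * fst w, g * snd w) =
     (a * b * c * d * g * fst (hom_upd x n e s w), a * b * c * d * g * snd (hom_upd x n e s w))"
  by (simp add: hom_upd_def wedge_def algebra_simps)

text \<open>Equating the right-hand side to zero is the dSKP equation for \<open>y\<close>. Taking
  \<open>s\<close> or \<open>w\<close> for \<open>y\<close> leaves a single term, which is how the
  updated pair is seen to be nonzero.\<close>

lemma wedge_hom_upd:
  "wedge (hom_upd x n e s w) y = wedge n w * wedge e x * wedge s y - wedge x n * wedge s e * wedge w y"
  by (simp add: hom_upd_def wedge_def algebra_simps)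

lemma wedge_commute: "wedge y x = - wedge x y"
  by (simp add: wedge_def)

lemma wedge_self [simp]: "wedge x x = 0"
  by (simp add: wedge_def)

definition eval_pair :: "'a::comm_ring_1 \<Rightarrow> 'a poly \<times> 'a poly \<Rightarrow> 'a \<times> 'a" where
  "eval_pair t p = (poly (fst p) t, poly (snd p) t)"

lemma wedge_eval_pair: "wedge (eval_pair t p) (eval_pair t q) = poly (wedge p q) t"
  by (simp add: wedge_def eval_pair_def)

lemma eval_pair_hom_upd:
  "eval_pair t (hom_upd x n e s w) =
     hom_upd (eval_pair t x) (eval_pair t n) (eval_pair t e) (eval_pair t s) (eval_pair t w)"
  by (simp add: hom_upd_def wedge_def eval_pair_def)

lemma eval_pair_hom_state: "eval_pair t (hom_state h m f) = hom_state (\<lambda>g. eval_pair t (h g)) m f"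
  by (induction m arbitrary: f) (simp_all add: eval_pair_hom_upd)

text \<open>Affine functions of the face are fixed points of the recurrence; this one takes no excluded value,
  so it witnesses that the nondegeneracy conditions are generic.\<close>

definition generic_weight :: "face \<Rightarrow> complex" where
  "generic_weight f = of_int (fst f) + 2 * of_int (snd f) + 1 / 2"

lemma hom_state_generic:
  "\<exists>q. q \<noteq> 0 \<and> hom_state (\<lambda>f. (generic_weight f, 1)) m f = (generic_weight f * q, q)"
proof (induction m arbitrary: f)
  case (Suc m)
  from Suc obtain q where q: "\<And>f. q f \<noteq> 0"
    "\<And>f. hom_state (\<lambda>f. (generic_weight f, 1)) m f = (generic_weight f * q f, q f)"
    by metis
  \<comment> \<open>Around the value x the neighbours are x + 2, x + 1, x - 2, x - 1, so the
    denominator (x - n) (x - s) - (x - e) (x - w) is -4 + 1.\<close>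
  have "upd_den (generic_weight f) (generic_weight (fst f, snd f + 1)) (generic_weight (fst f + 1, snd f))
      (generic_weight (fst f, snd f - 1)) (generic_weight (fst f - 1, snd f)) = -3"
    "upd_num (generic_weight f) (generic_weight (fst f, snd f + 1)) (generic_weight (fst f + 1, snd f))
      (generic_weight (fst f, snd f - 1)) (generic_weight (fst f - 1, snd f)) = -3 * generic_weight f"
    by (simp_all add: upd_den_def upd_num_def generic_weight_def algebra_simps)
  then show ?case
    using q(1) by (auto simp: q(2) hom_upd_affine)
qed auto

text \<open>Twice the weight is an odd integer; this is the purpose of the offset
  \<open>1 / 2\<close>.\<close>

lemma generic_weight_nonzero: "generic_weight f \<noteq> 0"
proof
  assume "generic_weight f = 0"
  then have "(of_int (2 * fst f + 4 * snd f + 1) :: complex) = 0"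
    by (simp add: generic_weight_def field_simps)
  then show False unfolding of_int_eq_0_iff by presburger
qed

text \<open>The coefficients 1 and 2 separate the vertical neighbours of a face from the horizontal
  ones, as the local move requires.\<close>

lemma generic_weight_eq_iff: "generic_weight f = generic_weight g \<longleftrightarrow> fst f + 2 * snd f = fst g + 2 * snd g"
proof -
  have "generic_weight f = generic_weight g \<longleftrightarrow>
      (of_int (fst f + 2 * snd f) :: complex) = of_int (fst g + 2 * snd g)"
    by (simp add: generic_weight_def)
  then show ?thesis unfolding of_int_eq_iff .
qed

section \<open>Points of the projective line and harmonic quadruples\<close>

definition hpair :: "riemann_sphere \<Rightarrow> complex \<times> complex" where
  "hpair p = (hnum p, hden p)"

lemma hdiff_wedge: "hdiff a b = wedge (hpair a) (hpair b)"
  by (simp add: hdiff_def wedge_def hpair_def)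

text \<open>The vectors with zero \<open>wedge\<close> against a nonzero vector form a line. The
  factor is read off at the coordinate of \<open>hpair p\<close> that is 1.\<close>

lemma proportional_hpair:
  assumes "wedge v (hpair p) = 0" "v \<noteq> (0, 0)"
  shows "\<exists>\<mu>. \<mu> \<noteq> 0 \<and> v = (\<mu> * hnum p, \<mu> * hden p)"
proof (cases p)
  case (Finite w)
  then show ?thesis using assms
    by (intro exI[of _ "snd v"]) (cases v, auto simp: wedge_def hpair_def)
next
  case Infty
  then show ?thesis using assms
    by (intro exI[of _ "fst v"]) (cases v, auto simp: wedge_def hpair_def)
qed

text \<open>A zero denominator would make the cross-ratio 0. The Pluecker relation then evaluates
  the product of the diagonals, with a factor 2, so all six pairs of points are distinct.\<close>

lemma harmonic_wedges:
  assumes "cross_ratio a b c d = -1"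
  defines "W \<equiv> \<lambda>x y. wedge (hpair x) (hpair y)"
  shows "W a b * W c d = - (W b c * W d a)" "W a c * W b d = 2 * (W a b * W c d)"
    "W a b \<noteq> 0" "W b c \<noteq> 0" "W c d \<noteq> 0" "W d a \<noteq> 0" "W a c \<noteq> 0" "W b d \<noteq> 0"
proof -
  have nz: "W b c * W d a \<noteq> 0"
    using assms(1) by (auto simp: cross_ratio_def hdiff_wedge W_def)
  then show 1: "W a b * W c d = - (W b c * W d a)"
    using assms(1) by (simp add: cross_ratio_def hdiff_wedge W_def field_simps)
  have "W a c * W b d = W a b * W c d - W b c * W d a"
    by (simp add: W_def wedge_def algebra_simps)
  with 1 show 2: "W a c * W b d = 2 * (W a b * W c d)" by simp
  have "W a b * W c d \<noteq> 0" using nz 1 by auto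
  then show "W a b \<noteq> 0" "W b c \<noteq> 0" "W c d \<noteq> 0" "W d a \<noteq> 0" "W a c \<noteq> 0" "W b d \<noteq> 0"
    using nz 2 by auto
qed

section \<open>The lifted dSKP solution\<close>

definition parity_class :: "int \<Rightarrow> bool" where
  "parity_class n \<longleftrightarrow> n mod 4 \<in> {0, 3}"

lemma parity_class_shift: "parity_class (n + 2) \<longleftrightarrow> \<not> parity_class n"
proof -
  have "(n + 2) mod 4 = 0 \<or> (n + 2) mod 4 = 3 \<longleftrightarrow> \<not> (n mod 4 = 0 \<or> n mod 4 = 3)"
    by presburger
  then show ?thesis by (simp add: parity_class_def)
qed

text \<open>The solution of the dSKP recurrence attached to \<open>z\<close>: every value of \<open>z\<close> occurs at two consecutive heights.
  An octahedron of the lattice then consists of two adjacent squares, or is degenerate because its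
  top and bottom repeat two of the other values.\<close>

definition lift :: "(int \<Rightarrow> int \<Rightarrow> riemann_sphere) \<Rightarrow> face \<Rightarrow> int \<Rightarrow> riemann_sphere" where
  "lift z f h = z ((fst f + snd f + h) div 2)
     ((h - (fst f + snd f)) div 2 + (if parity_class (fst f - snd f) = parity_class (h + 1) then 1 else 0))"

text \<open>The initial heights are 0 and 1. There \<open>h + 1\<close> is 1 or 2, outside
  \<open>parity_class\<close>, so the extra 1 in \<open>lift\<close> appears exactly in the second
  case of the weights.\<close>

lemma holo_weights_lift: "holo_weights z f = lift z f ((fst f + snd f) mod 2)"
proof -
  have 0: "parity_class ((fst f + snd f) mod 2 + 1) = False"
  proof -
    have "(fst f + snd f) mod 2 = 0 \<or> (fst f + snd f) mod 2 = 1" by presburger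
    then show ?thesis by (auto simp: parity_class_def)
  qed
  have e: "(fst f + snd f) mod 2 - (fst f + snd f) = - (fst f + snd f) + (fst f + snd f) mod 2" by simp
  show ?thesis
    unfolding lift_def 0 unfolding holo_weights_def Let_def parity_class_def e
    by (cases "(fst f - snd f) mod 4 \<in> {0, 3}"; simp only: if_True if_False simp_thms add_0_right)
qed

text \<open>If nondegenerate, the octahedron consists of the harmonic squares \<open>A B C D\<close>
  and \<open>D C E F\<close> with common side \<open>C D\<close>. Each turns its product of
  diagonals into twice a product of opposite sides, and up to a common sign both sides of the dSKP
  equation become \<open>2 * W A B * W C D * W F E\<close>. If degenerate, the bottom is
  \<open>D\<close>, the top is \<open>C\<close>, and the two terms agree by antisymmetry.\<close>

lemma lift_octahedron:
  assumes z: "discrete_holomorphic z" and par: "even (fst f + snd f + h)"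
  shows "\<exists>\<mu>. \<mu> \<noteq> 0 \<and>
    hom_upd (hpair (lift z f h)) (hpair (lift z (fst f, snd f + 1) (h + 1))) (hpair (lift z (fst f + 1, snd f) (h + 1)))
      (hpair (lift z (fst f, snd f - 1) (h + 1))) (hpair (lift z (fst f - 1, snd f) (h + 1))) =
    (\<mu> * hnum (lift z f (h + 2)), \<mu> * hden (lift z f (h + 2)))"
proof -
  define u v where "u = fst f" and "v = snd f"
  have fuv: "f = (u, v)" by (simp add: u_def v_def)
  define P Q where "P = (u + v + h) div 2 + 1" and "Q = (h - (u + v)) div 2 + 1"
  have PQ: "u + v = P - Q" "h = P + Q - 2"
    using par unfolding P_def Q_def fuv fst_conv snd_conv by presburger+
  \<comment> \<open>\<open>\<eta>\<close> holds in the degenerate case. \<open>\<epsilon>\<close>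
    tells which of the north and east, and which of the south and west neighbours, carries the
    additional shift.\<close>
  define \<epsilon> \<eta> where "\<epsilon> = (parity_class (u - v + 1) = parity_class (h + 2))"
    and "\<eta> = (parity_class (u - v) = parity_class (h + 1))"
  have pc: "(parity_class (u - v - 1) = parity_class (h + 2)) = (\<not> \<epsilon>)"
    "(parity_class (u - v) = parity_class (h + 3)) = (\<not> \<eta>)"
    using parity_class_shift[of "u - v - 1"] parity_class_shift[of "h + 1"]
    by (auto simp: \<epsilon>_def \<eta>_def algebra_simps)
  have d: "(u + v + h) div 2 = P - 1" "(h - (u + v)) div 2 = Q - 1"
    "(u + (v + 1) + (h + 1)) div 2 = P" "(h + 1 - (u + (v + 1))) div 2 = Q - 1"
    "(u + 1 + v + (h + 1)) div 2 = P" "(h + 1 - (u + 1 + v)) div 2 = Q - 1"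
    "(u + (v - 1) + (h + 1)) div 2 = P - 1" "(h + 1 - (u + (v - 1))) div 2 = Q"
    "(u - 1 + v + (h + 1)) div 2 = P - 1" "(h + 1 - (u - 1 + v)) div 2 = Q"
    "(u + v + (h + 2)) div 2 = P" "(h + 2 - (u + v)) div 2 = Q"
    using PQ by presburger+
  have L: "lift z f h = z (P - 1) (Q - 1 + of_bool \<eta>)"
    "lift z (fst f, snd f + 1) (h + 1) = z P (Q - 1 + of_bool (\<not> \<epsilon>))"
    "lift z (fst f + 1, snd f) (h + 1) = z P (Q - 1 + of_bool \<epsilon>)"
    "lift z (fst f, snd f - 1) (h + 1) = z (P - 1) (Q + of_bool \<epsilon>)"
    "lift z (fst f - 1, snd f) (h + 1) = z (P - 1) (Q + of_bool (\<not> \<epsilon>))"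
    "lift z f (h + 2) = z P (Q + of_bool (\<not> \<eta>))"
    unfolding lift_def fuv fst_conv snd_conv d of_bool_def pc[symmetric]
    by (simp_all add: \<epsilon>_def \<eta>_def algebra_simps)
  define A B C D E F where "A = z (P - 1) (Q - 1)" and "B = z P (Q - 1)" and "C = z P Q"
    and "D = z (P - 1) Q" and "E = z P (Q + 1)" and "F = z (P - 1) (Q + 1)"
  define W where "W x y = wedge (hpair x) (hpair y)" for x y
  have cr: "cross_ratio A B C D = -1" "cross_ratio D C E F = -1"
    using z[unfolded discrete_holomorphic_def, rule_format, of "P - 1" "Q - 1"]
      z[unfolded discrete_holomorphic_def, rule_format, of "P - 1" Q]
    by (simp_all add: A_def B_def C_def D_def E_def F_def)
  note H1 = harmonic_wedges[OF cr(1), folded W_def] and H2 = harmonic_wedges[OF cr(2), folded W_def]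
  have com: "W y x = - W x y" for x y unfolding W_def by (rule wedge_commute)
  have nz: "W B D \<noteq> 0" "W C D \<noteq> 0" "W F D \<noteq> 0" "W C A \<noteq> 0" "W D C \<noteq> 0" "W D B \<noteq> 0" "W C F \<noteq> 0" "W B A \<noteq> 0" "W D F \<noteq> 0"
    using H1(3-8) H2(3-8) com[of A B] com[of A C] com[of B D] com[of C D] com[of F D] by auto
  \<comment> \<open>The first condition is the dSKP equation. The second pairs the update with
    \<open>w\<close> or \<open>s\<close> and keeps it from being \<open>(0, 0)\<close>.\<close>
  have main: "\<exists>\<mu>. \<mu> \<noteq> 0 \<and> hom_upd (hpair x) (hpair n) (hpair e) (hpair s) (hpair w) = (\<mu> * hnum y, \<mu> * hden y)"
    if "W n w * W e x * W s y = W x n * W s e * W w y"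
      "W n w * W e x * W s w \<noteq> 0 \<or> W x n * W s e * W w s \<noteq> 0" for x n e s w y
  proof (rule proportional_hpair)
    show "wedge (hom_upd (hpair x) (hpair n) (hpair e) (hpair s) (hpair w)) (hpair y) = 0"
      using that(1) by (simp add: wedge_hom_upd W_def)
    have "wedge (hom_upd (hpair x) (hpair n) (hpair e) (hpair s) (hpair w)) (hpair w) \<noteq> 0 \<or>
        wedge (hom_upd (hpair x) (hpair n) (hpair e) (hpair s) (hpair w)) (hpair s) \<noteq> 0"
      using that(2) by (simp add: wedge_hom_upd W_def)
    then show "hom_upd (hpair x) (hpair n) (hpair e) (hpair s) (hpair w) \<noteq> (0, 0)"
      by (auto simp: wedge_def)
  qed
  have sq: "W B D * W C A = - 2 * (W A B * W C D)" "W F C * W D E = - 2 * (W C D * W F E)"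
    using H1(2) H2(2) com[of A C] com[of C F] com[of C D] com[of E F] by (simp_all add: mult.commute)
  show ?thesis
  proof (cases \<epsilon>; cases \<eta>)
    assume "\<epsilon>" "\<eta>"
    then have L': "lift z f h = D" "lift z (fst f, snd f + 1) (h + 1) = B" "lift z (fst f + 1, snd f) (h + 1) = C"
      "lift z (fst f, snd f - 1) (h + 1) = F" "lift z (fst f - 1, snd f) (h + 1) = D" "lift z f (h + 2) = C"
      unfolding L A_def B_def C_def D_def E_def F_def by simp_all
    show ?thesis unfolding L'
      by (rule main) (use nz com[of B D] com[of C D] in \<open>auto simp: algebra_simps\<close>)
  next
    assume "\<epsilon>" "\<not> \<eta>"
    then have L': "lift z f h = A" "lift z (fst f, snd f + 1) (h + 1) = B" "lift z (fst f + 1, snd f) (h + 1) = C"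
      "lift z (fst f, snd f - 1) (h + 1) = F" "lift z (fst f - 1, snd f) (h + 1) = D" "lift z f (h + 2) = E"
      unfolding L A_def B_def C_def D_def E_def F_def by simp_all
    have "W B D * W C A * W F E = W A B * W F C * W D E"
      using sq by (simp add: mult.assoc)
    then show ?thesis unfolding L' by (rule main) (use nz in auto)
  next
    assume "\<not> \<epsilon>" "\<eta>"
    then have L': "lift z f h = D" "lift z (fst f, snd f + 1) (h + 1) = C" "lift z (fst f + 1, snd f) (h + 1) = B"
      "lift z (fst f, snd f - 1) (h + 1) = D" "lift z (fst f - 1, snd f) (h + 1) = F" "lift z f (h + 2) = C"
      unfolding L A_def B_def C_def D_def E_def F_def by simp_all
    show ?thesis unfolding L'
      by (rule main) (use nz com[of C F] com[of B D] in \<open>auto simp: algebra_simps\<close>)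
  next
    assume "\<not> \<epsilon>" "\<not> \<eta>"
    then have L': "lift z f h = A" "lift z (fst f, snd f + 1) (h + 1) = C" "lift z (fst f + 1, snd f) (h + 1) = B"
      "lift z (fst f, snd f - 1) (h + 1) = D" "lift z (fst f - 1, snd f) (h + 1) = F" "lift z f (h + 2) = E"
      unfolding L A_def B_def C_def D_def E_def F_def by simp_all
    have "W C F * W B A * W D E = W F C * W D E * W A B"
      using com[of F C] com[of A B] by (simp add: algebra_simps)
    also have "\<dots> = W B D * W C A * W F E" unfolding sq by (simp add: algebra_simps)
    also have "\<dots> = W A C * W D B * W F E" using com[of A C] com[of B D] by simp
    finally show ?thesis unfolding L' by (rule main) (use nz in auto)
  qed
qed

text \<open>The height of a face always has the parity of its coordinate sum. Step \<open>m\<close>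
  raises the faces at height \<open>m\<close> to \<open>m + 2\<close>.\<close>

definition height :: "nat \<Rightarrow> face \<Rightarrow> int" where
  "height m f = (if even (fst f + snd f + int m) then int m else int m + 1)"

text \<open>The scale factors are products of nonzero ones, so the recurrence never reaches
  \<open>(0, 0)\<close> from these weights, even where values are infinite or coincide.\<close>

lemma hom_state_lift:
  assumes z: "discrete_holomorphic z"
  shows "\<exists>\<mu>. \<mu> \<noteq> 0 \<and> hom_state (\<lambda>g. hpair (holo_weights z g)) m f =
    (\<mu> * hnum (lift z f (height m f)), \<mu> * hden (lift z f (height m f)))"
proof (induction m arbitrary: f)
  case 0
  have "height 0 f = (fst f + snd f) mod 2" unfolding height_def by (simp add: odd_iff_mod_2_eq_one even_iff_mod_2_eq_zero)
  then show ?case by (intro exI[of _ 1]) (simp add: holo_weights_lift hpair_def)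
next
  case (Suc m)
  let ?h = "hom_state (\<lambda>g. hpair (holo_weights z g))"
  from Suc obtain \<mu> where \<mu>: "\<And>f. \<mu> f \<noteq> 0"
    "\<And>f. ?h m f = (\<mu> f * fst (hpair (lift z f (height m f))), \<mu> f * snd (hpair (lift z f (height m f))))"
    unfolding hpair_def fst_conv snd_conv by metis
  show ?case
  proof (cases "even (fst f + snd f + int m)")
    case True
    have h: "height m f = int m" "height (Suc m) f = int m + 2"
      "height m (fst f, snd f + 1) = int m + 1" "height m (fst f + 1, snd f) = int m + 1"
      "height m (fst f, snd f - 1) = int m + 1" "height m (fst f - 1, snd f) = int m + 1"
      using True by (auto simp: height_def)
    obtain \<nu> where \<nu>: "\<nu> \<noteq> 0"
      "hom_upd (hpair (lift z f (int m))) (hpair (lift z (fst f, snd f + 1) (int m + 1))) (hpair (lift z (fst f + 1, snd f) (int m + 1)))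
      (hpair (lift z (fst f, snd f - 1) (int m + 1))) (hpair (lift z (fst f - 1, snd f) (int m + 1))) =
      (\<nu> * hnum (lift z f (int m + 2)), \<nu> * hden (lift z f (int m + 2)))"
      using lift_octahedron[OF z True] by blast
    have "?h (Suc m) f = hom_upd (?h m f) (?h m (fst f, snd f + 1)) (?h m (fst f + 1, snd f))
       (?h m (fst f, snd f - 1)) (?h m (fst f - 1, snd f))"
      using True by simp
    also have "\<dots> = (\<mu> f * \<mu> (fst f, snd f + 1) * \<mu> (fst f + 1, snd f) * \<mu> (fst f, snd f - 1) * \<mu> (fst f - 1, snd f) * \<nu> * hnum (lift z f (int m + 2)),
       \<mu> f * \<mu> (fst f, snd f + 1) * \<mu> (fst f + 1, snd f) * \<mu> (fst f, snd f - 1) * \<mu> (fst f - 1, snd f) * \<nu> * hden (lift z f (int m + 2)))"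
      unfolding \<mu>(2) hom_upd_scale h \<nu>(2) by simp
    finally show ?thesis
      unfolding h(2) using \<mu>(1) \<nu>(1)
      by (intro exI[of _ "\<mu> f * \<mu> (fst f, snd f + 1) * \<mu> (fst f + 1, snd f) * \<mu> (fst f, snd f - 1) *
        \<mu> (fst f - 1, snd f) * \<nu>"] conjI) (simp_all del: hom_state.simps)
  next
    case False
    then have "height (Suc m) f = height m f" by (auto simp: height_def)
    moreover have "?h (Suc m) f = ?h m f" using False by simp
    ultimately show ?thesis using Suc[of f] by (simp only:)
  qed
qed

section \<open>Specialisation to discrete holomorphic functions\<close>

lemma aztec_Z_0: "aztec_Z 0 c \<phi> a = 1"
proof -
  have "aztec_vertices 0 c = {}" by (auto simp: aztec_vertices_def internal_faces_def)
  then show ?thesis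
    by (simp add: aztec_Z_eq_dimer_sum[of 0 0] dimer_sum_empty)
qed

text \<open>\<open>a m\<close> belongs to the diamond of size \<open>k - m\<close>, and
  \<open>par\<close> makes the faces updated in step \<open>m\<close> active there. Nondegeneracy
  concerns only faces of the initial diamond and finitely many steps, hence finitely many
  conditions.\<close>

lemma aztec_Y_iterate:
  fixes a :: "nat \<Rightarrow> face \<Rightarrow> complex"
  assumes K: "kasteleyn k c \<phi>" and par: "odd (fst c + snd c + int k)"
    and nz: "\<And>m g. m \<le> k \<Longrightarrow> g \<in> aztec_faces k c \<Longrightarrow> a m g \<noteq> 0"
    and step: "\<And>m f. m < k \<Longrightarrow> even (fst f + snd f + int m) \<Longrightarrow> insert f (neighbours f) \<subseteq> aztec_faces k c \<Longrightarrow>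
      face_den (a m) f \<noteq> 0 \<and> a (Suc m) f * face_den (a m) f = face_num (a m) f \<and>
      a m (fst f, snd f + 1) \<noteq> a m (fst f + 1, snd f) \<and> a m (fst f, snd f + 1) \<noteq> a m (fst f - 1, snd f) \<and>
      a m (fst f, snd f - 1) \<noteq> a m (fst f + 1, snd f) \<and> a m (fst f, snd f - 1) \<noteq> a m (fst f - 1, snd f)"
    and keep: "\<And>m g. odd (fst g + snd g + int m) \<Longrightarrow> a (Suc m) g = a m g"
  shows "aztec_Z k c \<phi> (a 0) \<noteq> 0" "aztec_Y_complex k c \<phi> (a 0) = a k c"
proof -
  have "aztec_Z j c \<phi> (a (k - j)) \<noteq> 0 \<and> aztec_Y_complex j c \<phi> (a (k - j)) = a k c" if "j \<le> k" for j
    using that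
  proof (induction j)
    case 0
    then show ?case by (simp add: aztec_Z_0 aztec_Y_complex_0)
  next
    case (Suc j)
    define m where "m = k - Suc j"
    have m: "m < k" "k - j = Suc m" "j + m + 1 = k" using Suc.prems by (auto simp: m_def)
    have IH: "aztec_Z j c \<phi> (a (Suc m)) \<noteq> 0" "aztec_Y_complex j c \<phi> (a (Suc m)) = a k c"
      using Suc m by auto
    have K': "kasteleyn (Suc j) c \<phi>"
      using K Suc.prems by (auto simp: kasteleyn_iff internal_faces_def)
    have par': "even (fst c + snd c + int j + int m)" using par m(3) by presburger
    have sub: "aztec_faces (Suc j) c \<subseteq> aztec_faces k c"
      using Suc.prems by (auto simp: mem_aztec_faces)
    have st: "face_den (a m) f \<noteq> 0 \<and> a (Suc m) f * face_den (a m) f = face_num (a m) f \<and>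
      a m (fst f, snd f + 1) \<noteq> a m (fst f + 1, snd f) \<and> a m (fst f, snd f + 1) \<noteq> a m (fst f - 1, snd f) \<and>
      a m (fst f, snd f - 1) \<noteq> a m (fst f + 1, snd f) \<and> a m (fst f, snd f - 1) \<noteq> a m (fst f - 1, snd f)"
      "a (Suc m) f \<noteq> 0"
      if f: "f \<in> active (int m) (Suc j) c" for f
    proof -
      have F: "f \<in> aztec_faces k c" "neighbours f \<subseteq> aztec_faces k c"
        using aztec_faces_split(1)[OF par', of "Suc j"] neighbours_active[OF f] f sub by auto
      show "a (Suc m) f \<noteq> 0" using nz[of "Suc m" f] F m by simp
      show "face_den (a m) f \<noteq> 0 \<and> a (Suc m) f * face_den (a m) f = face_num (a m) f \<and>
      a m (fst f, snd f + 1) \<noteq> a m (fst f + 1, snd f) \<and> a m (fst f, snd f + 1) \<noteq> a m (fst f - 1, snd f) \<and>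
      a m (fst f, snd f - 1) \<noteq> a m (fst f + 1, snd f) \<and> a m (fst f, snd f - 1) \<noteq> a m (fst f - 1, snd f)"
        by (rule step[OF m(1)]) (use f F in \<open>simp_all add: active_def\<close>)
    qed
    have nzm: "a m g \<noteq> 0" if "g \<in> aztec_faces (Suc j) c" for g
      using nz[of m g] that sub m by auto
    have "aztec_Z (Suc j) c \<phi> (a m) \<noteq> 0 \<and> aztec_Y_complex (Suc j) c \<phi> (a m) = aztec_Y_complex j c \<phi> (a (Suc m))"
      using aztec_Y_renewal[OF K' par', of "a m" "a (Suc m)"] nzm st keep IH(1) by blast
    then show ?case using IH(2) by (simp add: m_def[symmetric])
  qed
  from this[of k] show "aztec_Z k c \<phi> (a 0) \<noteq> 0" "aztec_Y_complex k c \<phi> (a 0) = a k c" by simp_all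
qed

section \<open>Homogenised polynomials and the passage to the limit\<close>

lemma hom_poly_dehomogenize:
  assumes "\<And>f. f \<in> F \<Longrightarrow> y f \<noteq> 0"
  shows "hom_poly F \<delta> C x y = (\<Prod>f\<in>F. y f ^ \<delta> f) * hom_poly F \<delta> C (\<lambda>f. x f / y f) (\<lambda>_. 1)"
proof -
  have "(\<Prod>f\<in>F. x f ^ m f * y f ^ (\<delta> f - m f)) = (\<Prod>f\<in>F. y f ^ \<delta> f) * (\<Prod>f\<in>F. (x f / y f) ^ m f * 1 ^ (\<delta> f - m f))"
    if m: "m \<in> (\<Pi>\<^sub>E f\<in>F. {..\<delta> f})" for m
    unfolding prod.distrib[symmetric]
  proof (rule prod.cong[OF refl])
    fix f assume f: "f \<in> F"
    then have "m f \<le> \<delta> f" using m by auto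
    then have "y f ^ \<delta> f = y f ^ m f * y f ^ (\<delta> f - m f)" by (simp flip: power_add)
    then show "x f ^ m f * y f ^ (\<delta> f - m f) = y f ^ \<delta> f * ((x f / y f) ^ m f * 1 ^ (\<delta> f - m f))"
      using assms[OF f] by (simp add: power_divide)
  qed
  then show ?thesis
    unfolding hom_poly_def sum_distrib_left by (intro sum.cong refl) (simp add: mult_ac)
qed

lemma isCont_hom_poly:
  "isCont (\<lambda>t. hom_poly F \<delta> C (\<lambda>f. poly (p f) t) (\<lambda>f. poly (q f) t)) t"
  unfolding hom_poly_def by (intro continuous_intros poly_isCont)

text \<open>\<open>x\<close> itself may lie in \<open>T\<close>, so the limit is taken over a
  punctured neighbourhood.\<close>

lemma isCont_zero_off_finite:
  fixes g :: "complex \<Rightarrow> complex"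
  assumes "finite T" "\<And>t. t \<notin> T \<Longrightarrow> g t = 0" "isCont g x"
  shows "g x = 0"
proof -
  have "open (- (T - {x}))" using assms(1) by (intro open_Compl finite_imp_closed) auto
  then have "eventually (\<lambda>t. t \<notin> T) (at x)"
    unfolding eventually_at_topological by (intro exI[of _ "- (T - {x})"]) auto
  then have "eventually (\<lambda>t. g t = 0) (at x)"
    by (rule eventually_mono) (rule assms(2))
  then have "(g \<longlongrightarrow> 0) (at x)" by (rule tendsto_eventually)
  moreover have "(g \<longlongrightarrow> g x) (at x)" using assms(3) by (simp add: isCont_def)
  ultimately show ?thesis using tendsto_unique[of "at x" g 0 "g x"] by simp
qed

theorem aztec_Y_value_holo_weights:
  assumes z: "discrete_holomorphic z" and K: "kasteleyn k c \<phi>" and par: "odd (fst c + snd c + int k)"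
    and val: "aztec_Y_value k c \<phi> (holo_weights z) v"
  shows "v = lift z c (int k + 1)"
proof -
  define F where "F = aztec_faces k c"
  define \<alpha> where "\<alpha> = holo_weights z"
  have finF: "finite F" by (simp add: F_def finite_aztec_faces)
  obtain \<delta> P Q where PQ: "\<And>b. b \<in> aztec_Y_domain k c \<phi> \<Longrightarrow>
      hom_poly F \<delta> P b (\<lambda>_. 1) = aztec_Y_complex k c \<phi> b * hom_poly F \<delta> Q b (\<lambda>_. 1)"
    and nz0: "(hom_poly F \<delta> P (\<lambda>f. hnum (\<alpha> f)) (\<lambda>f. hden (\<alpha> f)), hom_poly F \<delta> Q (\<lambda>f. hnum (\<alpha> f)) (\<lambda>f. hden (\<alpha> f))) \<noteq> (0, 0)"
    and v: "v = proj_point (hom_poly F \<delta> P (\<lambda>f. hnum (\<alpha> f)) (\<lambda>f. hden (\<alpha> f))) (hom_poly F \<delta> Q (\<lambda>f. hnum (\<alpha> f)) (\<lambda>f. hden (\<alpha> f)))"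
    using val unfolding aztec_Y_value_def ratfun_value_def Let_def F_def \<alpha>_def by blast
  \<comment> \<open>A line in homogeneous coordinates: \<open>t = 0\<close> gives the weights of
    \<open>z\<close>, infinite ones included, and \<open>t = 1\<close> the generic weights.\<close>
  define H :: "face \<Rightarrow> complex poly \<times> complex poly" where
    "H f = ([:hnum (\<alpha> f), generic_weight f - hnum (\<alpha> f):], [:hden (\<alpha> f), 1 - hden (\<alpha> f):])" for f
  define S where "S = hom_state H"
  have S1: "\<exists>q. q \<noteq> 0 \<and> eval_pair 1 (S m f) = (generic_weight f * q, q)" for m f
    unfolding S_def eval_pair_hom_state using hom_state_generic[of m f] by (simp add: eval_pair_def H_def)
  have S0: "\<exists>\<mu>. \<mu> \<noteq> 0 \<and> eval_pair 0 (S m f) =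
      (\<mu> * hnum (lift z f (height m f)), \<mu> * hden (lift z f (height m f)))" for m f
    unfolding S_def eval_pair_hom_state using hom_state_lift[OF z, of m f]
    by (simp add: eval_pair_def H_def hpair_def \<alpha>_def)
  define roots where "roots p = {t. poly p t = 0}" for p :: "complex poly"
  \<comment> \<open>Off \<open>T\<close> all weights of all steps are finite and nonzero, and they
    differ wherever the generic weights do. Each polynomial involved is nonzero at
    \<open>t = 1\<close>, so \<open>T\<close> is finite.\<close>
  define T where "T = (\<Union>m\<le>k. (\<Union>f\<in>F. roots (fst (S m f)) \<union> roots (snd (S m f))) \<union>
      (\<Union>f\<in>F. \<Union>g\<in>{g \<in> F. generic_weight f \<noteq> generic_weight g}. roots (wedge (S m f) (S m g))))"
  have fin_roots: "finite (roots p)" if "poly p 1 \<noteq> 0" for p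
    unfolding roots_def using that by (intro poly_roots_finite) auto
  have "finite T"
  proof -
    have "poly (fst (S m f)) 1 \<noteq> 0" "poly (snd (S m f)) 1 \<noteq> 0" for m f
      using S1[of m f] generic_weight_nonzero[of f] by (auto simp: eval_pair_def)
    moreover have "poly (wedge (S m f) (S m g)) 1 \<noteq> 0" if "generic_weight f \<noteq> generic_weight g" for m f g
    proof -
      obtain q q' where "q \<noteq> 0" "eval_pair 1 (S m f) = (generic_weight f * q, q)"
        "q' \<noteq> 0" "eval_pair 1 (S m g) = (generic_weight g * q', q')"
        using S1 by metis
      then show ?thesis using that unfolding wedge_eval_pair[symmetric] by (simp add: wedge_def)
    qed
    ultimately show ?thesis unfolding T_def using finF by (auto intro!: fin_roots)
  qed
  define p q where "p f = fst (H f)" and "q f = snd (H f)" for f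
  \<comment> \<open>The cross-multiplied equality of the point given by \<open>P\<close> and
    \<open>Q\<close> with the point reached by the recurrence. Being free of division it makes sense
    at \<open>t = 0\<close>.\<close>
  define G where "G t = hom_poly F \<delta> P (\<lambda>f. poly (p f) t) (\<lambda>f. poly (q f) t) * poly (snd (S k c)) t -
      hom_poly F \<delta> Q (\<lambda>f. poly (p f) t) (\<lambda>f. poly (q f) t) * poly (fst (S k c)) t" for t
  have "G t = 0" if t: "t \<notin> T" for t
  proof -
    define a where "a m f = poly (fst (S m f)) t / poly (snd (S m f)) t" for m f
    have nz: "poly (fst (S m f)) t \<noteq> 0" "poly (snd (S m f)) t \<noteq> 0" if "m \<le> k" "f \<in> F" for m f
      using t that by (auto simp: T_def roots_def)
    have neq: "a m f \<noteq> a m g" if "m \<le> k" "f \<in> F" "g \<in> F" "generic_weight f \<noteq> generic_weight g" for m f g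
    proof -
      have "poly (wedge (S m f) (S m g)) t \<noteq> 0"
        using t that unfolding T_def roots_def by blast
      then show ?thesis using nz[OF that(1,2)] nz[OF that(1,3)]
        by (simp add: a_def wedge_def field_simps)
    qed
    have Spair: "eval_pair t (S m f) = (a m f * poly (snd (S m f)) t, poly (snd (S m f)) t)" if "m \<le> k" "f \<in> F" for m f
      using nz[OF that] by (simp add: eval_pair_def a_def)
    have nz': "a m g \<noteq> 0" if "m \<le> k" "g \<in> aztec_faces k c" for m g
      using nz[of m g] that by (simp add: a_def F_def)
    have keep: "a (Suc m) g = a m g" if "odd (fst g + snd g + int m)" for m g
      using that by (simp add: a_def S_def)
    have st: "face_den (a m) f \<noteq> 0 \<and> a (Suc m) f * face_den (a m) f = face_num (a m) f \<and>
        a m (fst f, snd f + 1) \<noteq> a m (fst f + 1, snd f) \<and> a m (fst f, snd f + 1) \<noteq> a m (fst f - 1, snd f) \<and>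
        a m (fst f, snd f - 1) \<noteq> a m (fst f + 1, snd f) \<and> a m (fst f, snd f - 1) \<noteq> a m (fst f - 1, snd f)"
      if m: "m < k" and ev: "even (fst f + snd f + int m)" and sub: "insert f (neighbours f) \<subseteq> aztec_faces k c" for m f
    proof -
      have mem: "f \<in> F" "(fst f, snd f + 1) \<in> F" "(fst f + 1, snd f) \<in> F" "(fst f, snd f - 1) \<in> F" "(fst f - 1, snd f) \<in> F"
        using sub by (auto simp: neighbours_def F_def)
      have mk: "m \<le> k" "Suc m \<le> k" using m by auto
      define M where "M = poly (snd (S m f)) t * poly (snd (S m (fst f, snd f + 1))) t *
        poly (snd (S m (fst f + 1, snd f))) t * poly (snd (S m (fst f, snd f - 1))) t * poly (snd (S m (fst f - 1, snd f))) t"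
      have "eval_pair t (S (Suc m) f) = hom_upd (eval_pair t (S m f)) (eval_pair t (S m (fst f, snd f + 1)))
          (eval_pair t (S m (fst f + 1, snd f))) (eval_pair t (S m (fst f, snd f - 1))) (eval_pair t (S m (fst f - 1, snd f)))"
        using ev by (simp add: S_def eval_pair_hom_upd)
      also have "\<dots> = (face_num (a m) f * M, face_den (a m) f * M)"
        unfolding Spair[OF mk(1) mem(1)] Spair[OF mk(1) mem(2)] Spair[OF mk(1) mem(3)] Spair[OF mk(1) mem(4)]
          Spair[OF mk(1) mem(5)] hom_upd_affine face_num_def face_den_def M_def ..
      finally have e: "poly (fst (S (Suc m) f)) t = face_num (a m) f * M" "poly (snd (S (Suc m) f)) t = face_den (a m) f * M"
        by (simp_all add: eval_pair_def)
      then have "face_den (a m) f \<noteq> 0" "M \<noteq> 0" using nz[OF mk(2) mem(1)] by auto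
      moreover from this have "a (Suc m) f * face_den (a m) f = face_num (a m) f"
        by (simp add: a_def e)
      ultimately show ?thesis
        using mem by (intro conjI neq mk(1)) (simp_all add: generic_weight_eq_iff)
    qed
    have it: "aztec_Z k c \<phi> (a 0) \<noteq> 0" "aztec_Y_complex k c \<phi> (a 0) = a k c"
      using aztec_Y_iterate[of k c \<phi> a, OF K par nz' st keep] by blast+
    have a0: "a 0 = (\<lambda>f. poly (p f) t / poly (q f) t)"
      by (simp add: fun_eq_iff a_def S_def p_def q_def)
    have qnz: "poly (q f) t \<noteq> 0" if "f \<in> F" for f
      using nz(2)[of 0 f] that by (simp add: S_def q_def)
    have "a 0 \<in> aztec_Y_domain k c \<phi>"
      using it(1) nz[of 0] by (auto simp: aztec_Y_domain_def a_def F_def)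
    from PQ[OF this] have "hom_poly F \<delta> P (a 0) (\<lambda>_. 1) = a k c * hom_poly F \<delta> Q (a 0) (\<lambda>_. 1)"
      unfolding it(2) .
    moreover have "hom_poly F \<delta> C (\<lambda>f. poly (p f) t) (\<lambda>f. poly (q f) t) =
        (\<Prod>f\<in>F. poly (q f) t ^ \<delta> f) * hom_poly F \<delta> C (a 0) (\<lambda>_. 1)" for C
      unfolding a0 by (rule hom_poly_dehomogenize) (rule qnz)
    ultimately have "hom_poly F \<delta> P (\<lambda>f. poly (p f) t) (\<lambda>f. poly (q f) t) =
        a k c * hom_poly F \<delta> Q (\<lambda>f. poly (p f) t) (\<lambda>f. poly (q f) t)"
      by simp
    moreover have "c \<in> F" by (simp add: F_def mem_aztec_faces)
    ultimately show "G t = 0"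
      using nz(2)[of k c] by (simp add: G_def a_def)
  qed
  moreover have "isCont G 0"
    unfolding G_def by (intro continuous_intros isCont_hom_poly poly_isCont)
  ultimately have G0: "G 0 = 0" using isCont_zero_off_finite[OF \<open>finite T\<close>] by blast
  define X where "X = lift z c (int k + 1)"
  have "height k c = int k + 1" using par by (auto simp: height_def)
  then obtain \<mu> where \<mu>: "\<mu> \<noteq> 0" "poly (fst (S k c)) 0 = \<mu> * hnum X" "poly (snd (S k c)) 0 = \<mu> * hden X"
    using S0[of k c] by (auto simp: eval_pair_def X_def)
  \<comment> \<open>At \<open>t = 0\<close> the recurrence gives a nonzero multiple of the
    coordinates of \<open>X\<close>. As \<open>(p0, q0)\<close> is nonzero too, the vanishing of
    \<open>G\<close> identifies the two points.\<close>
  define p0 q0 where "p0 = hom_poly F \<delta> P (\<lambda>f. hnum (\<alpha> f)) (\<lambda>f. hden (\<alpha> f))"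
    and "q0 = hom_poly F \<delta> Q (\<lambda>f. hnum (\<alpha> f)) (\<lambda>f. hden (\<alpha> f))"
  have "p0 * (\<mu> * hden X) = q0 * (\<mu> * hnum X)"
    using G0 by (simp add: G_def p_def q_def H_def \<mu> p0_def q0_def)
  then have "p0 * hden X = q0 * hnum X" using \<mu>(1) by (simp add: algebra_simps)
  moreover have "p0 \<noteq> 0 \<or> q0 \<noteq> 0" using nz0 by (auto simp: p0_def q0_def)
  ultimately have "proj_point p0 q0 = X"
    by (cases X) (auto simp: proj_point_def)
  then show ?thesis by (simp add: v p0_def q0_def X_def)
qed

theorem corollary6p5:
  fixes z :: "int \<Rightarrow> int \<Rightarrow> riemann_sphere"
    and i j u v :: int
    and \<phi> :: "dart \<Rightarrow> complex"
  assumes "discrete_holomorphic z"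
    and "i + j \<ge> 2"
    and "u + v = i - j + 1"
    and "kasteleyn (nat (i + j - 2)) (u, v) \<phi>"
    and "aztec_Y_defined (nat (i + j - 2)) (u, v) \<phi> (holo_weights z)"
  shows "((i + j) mod 4 \<in> {0, 3} \<longrightarrow> (u - v) mod 4 \<in> {0, 3} \<longrightarrow>
            z i j = aztec_Y (nat (i + j - 2)) (u, v) \<phi> (holo_weights z)) \<and>
         ((i + j) mod 4 \<in> {1, 2} \<longrightarrow> (u - v) mod 4 \<in> {1, 2} \<longrightarrow>
            z i j = aztec_Y (nat (i + j - 2)) (u, v) \<phi> (holo_weights z))"
proof -
  define k where "k = nat (i + j - 2)"
  have k: "int k = i + j - 2" using assms(2) by (simp add: k_def)
  have par: "odd (fst (u, v) + snd (u, v) + int k)"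
    using assms(3) k unfolding fst_conv snd_conv by presburger
  \<comment> \<open>Every value coincides with the lifted one, so \<open>THE\<close> is determined
    once a value exists, which \<open>aztec_Y_defined\<close> provides.\<close>
  have uniq: "y = lift z (u, v) (int k + 1)" if "aztec_Y_value k (u, v) \<phi> (holo_weights z) y" for y
    by (rule aztec_Y_value_holo_weights[OF assms(1) _ par that]) (use assms(4) in \<open>simp add: k_def\<close>)
  moreover obtain y where y: "aztec_Y_value k (u, v) \<phi> (holo_weights z) y"
    using assms(5) by (auto simp: aztec_Y_defined_def k_def)
  ultimately have Y: "aztec_Y k (u, v) \<phi> (holo_weights z) = lift z (u, v) (int k + 1)"
    unfolding aztec_Y_def by (metis the_equality)
  \<comment> \<open>At height \<open>k + 1 = i + j - 1\<close> the indices of the lift start as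
    \<open>i\<close> and \<open>j - 1\<close>; equality of the classes of \<open>u - v\<close> and
    \<open>i + j\<close> adds the missing 1.\<close>
  have "z i j = lift z (u, v) (int k + 1)" if "parity_class (u - v) = parity_class (i + j)"
  proof -
    have "(u + v + (int k + 1)) div 2 = i" "(int k + 1 - (u + v)) div 2 + 1 = j" "int k + 1 + 1 = i + j"
      using assms(3) k by presburger+
    then show ?thesis using that by (simp add: lift_def)
  qed
  then show ?thesis
    unfolding k_def[symmetric] Y by (auto simp: parity_class_def)
qed

end
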